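(* Over the domain $(\mathbb{Z},<,=)$, the system has a winning strategy in the single-sided prompt-CLTL game with winning condition $\phi$ over the set of variables $V$ if and only if she has a winning strategy in the single-sided CLTL game with winning condition $c(\phi)$ over the set of variables $V\cup\{x^a_c,y^a_c\}$, where $x^a_c,y^a_c$ are fresh look-ahead variables owned by the system.
   Context: Variables: finite $V=V^a\sqcup V^b$ (look-ahead / future-blind). Look-ahead terms $X^iy$ ($y\in V^a$); constraints $t_1<t_2$ or $t_1=t_2$, both look-ahead terms or both future-blind variables. CLTL: $\phi::=c\mid\lnot\phi\mid\phi\lor\phi\mid X\phi\mid\phi U\phi$, interpreted on concrete models $\sigma$ (sequences of maps $V\to\mathbb{Z}$) with $\sigma,i\models X^ax<X^by$ iff $\sigma(i+a)(x)<\sigma(i+b)(y)$, future-blind constraints evaluated at position $i$, rest as in LTL; $F$, $G$, $\Rightarrow$ are standard abbreviations. Prompt-CLTL adds $\mathbf{F_P}\phi$; it is interpreted with a bound $k\ge0$: $(\sigma,i,k)\models\mathbf{F_P}\phi$ iff there is $j$ with $i\le j\le i+k$ and $(\sigma,j,k)\models\phi$, other cases as in CLTL (with $k$ passed along); $(\sigma,k)\models\phi$ means $(\sigma,0,k)\models\phi$. Single-sided games: the environment owns only future-blind variables $\mathit{EV}=\mathit{EV}^b\subseteq V^b$, the system owns the remaining future-blind variables and all look-ahead variables; each round the environment picks a valuation of $\mathit{EV}$ in $\mathbb{Z}$, then the system (knowing the history) picks a valuation of its variables. In the CLTL game the system wins a play with concrete model $\sigma$ iff $\sigma,0\models\phi$,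 and a winning strategy wins all consistent plays. In the prompt-CLTL game, a system strategy is winning if there is a bound $k\ge0$ such that $(\sigma,k)\models\phi$ for all concrete models $\sigma$ of plays consistent with it. Let $p$ be the constraint $x^a_c=y^a_c$. $\mathit{rel}_p(\phi)$ is obtained from $\phi$ by recursively replacing every subformula $\mathbf{F_P}\psi$ by $(p\Rightarrow(p\,U(\lnot p\,U\,\psi)))\wedge(\lnot p\Rightarrow(\lnot p\,U(p\,U\,\psi)))$, and $c(\phi)=(GF p\wedge GF\lnot p)\wedge\mathit{rel}_p(\phi)$.
   Formalization: The winning condition φ is required to have every F_P under an even number of negations; without this the claim fails, e.g. for φ = ¬F_P(x=y) ∧ X(x=y) with look-ahead variables x, y. *)

theory Defs
  imports Main "HOL-Library.FuncSet"
begin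

section \<open>Syntax\<close>

datatype rel = Less | Equal

text \<open>
  \<open>LookAhead r a x b y\<close> relates the terms \<open>X\<^sup>a x\<close> and \<open>X\<^sup>b y\<close>. The division of the variables into
  look-ahead variables \<open>Va\<close> and future-blind variables \<open>Vb\<close> is imposed by \<open>constr_over\<close>.
\<close>

datatype 'v constr =
    LookAhead rel nat 'v nat 'v
  | FutureBlind rel 'v 'v

datatype 'v cltl =
    Constr "'v constr"
  | Neg "'v cltl"
  | Disj "'v cltl" "'v cltl"
  | Next "'v cltl"
  | Until "'v cltl" "'v cltl"

definition Conj :: "'v cltl \<Rightarrow> 'v cltl \<Rightarrow> 'v cltl" where
  "Conj \<phi> \<psi> = Neg (Disj (Neg \<phi>) (Neg \<psi>))"

definition Imp :: "'v cltl \<Rightarrow> 'v cltl \<Rightarrow> 'v cltl" where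
  "Imp \<phi> \<psi> = Disj (Neg \<phi>) \<psi>"

text \<open>The syntax has no constant for truth; \<open>\<phi> \<or> \<not> \<phi>\<close> is used in its place.\<close>

definition Finally :: "'v cltl \<Rightarrow> 'v cltl" where
  "Finally \<phi> = Until (Disj \<phi> (Neg \<phi>)) \<phi>"

definition Globally :: "'v cltl \<Rightarrow> 'v cltl" where
  "Globally \<phi> = Neg (Finally (Neg \<phi>))"

datatype 'v prompt_cltl =
    PConstr "'v constr"
  | PNeg "'v prompt_cltl"
  | PDisj "'v prompt_cltl" "'v prompt_cltl"
  | PNext "'v prompt_cltl"
  | PUntil "'v prompt_cltl" "'v prompt_cltl"
  | FPrompt "'v prompt_cltl"

primrec constr_over :: "'v set \<Rightarrow> 'v set \<Rightarrow> 'v constr \<Rightarrow> bool" where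
  "constr_over Va Vb (LookAhead r a x b y) \<longleftrightarrow> x \<in> Va \<and> y \<in> Va"
| "constr_over Va Vb (FutureBlind r x y) \<longleftrightarrow> x \<in> Vb \<and> y \<in> Vb"

primrec prompt_over :: "'v set \<Rightarrow> 'v set \<Rightarrow> 'v prompt_cltl \<Rightarrow> bool" where
  "prompt_over Va Vb (PConstr c) \<longleftrightarrow> constr_over Va Vb c"
| "prompt_over Va Vb (PNeg \<phi>) \<longleftrightarrow> prompt_over Va Vb \<phi>"
| "prompt_over Va Vb (PDisj \<phi> \<psi>) \<longleftrightarrow> prompt_over Va Vb \<phi> \<and> prompt_over Va Vb \<psi>"
| "prompt_over Va Vb (PNext \<phi>) \<longleftrightarrow> prompt_over Va Vb \<phi>"
| "prompt_over Va Vb (PUntil \<phi> \<psi>) \<longleftrightarrow> prompt_over Va Vb \<phi> \<and> prompt_over Va Vb \<psi>"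
| "prompt_over Va Vb (FPrompt \<phi>) \<longleftrightarrow> prompt_over Va Vb \<phi>"

text \<open>
  \<open>prompt_polarity b \<phi>\<close>: every occurrence of the prompt operator in \<open>\<phi>\<close> is below an even (\<open>b = True\<close>)
  resp. odd (\<open>b = False\<close>) number of negations. As usual for prompt logics, the operator may only
  occur positively. With negative occurrences the reduction below is wrong: for look-ahead
  variables \<open>x\<close>, \<open>y\<close>, let \<open>q\<close> be the constraint \<open>x = y\<close>, and let \<open>\<phi>\<close> be the conjunction of \<open>X q\<close>
  and the negation of \<open>FPrompt q\<close>. The system satisfies \<open>\<phi>\<close> with bound \<open>0\<close>, but its translation
  is unsatisfiable, because \<open>X q\<close> implies the translation of \<open>FPrompt q\<close>.
\<close>

primrec prompt_polarity :: "bool \<Rightarrow> 'v prompt_cltl \<Rightarrow> bool" where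
  "prompt_polarity b (PConstr c) \<longleftrightarrow> True"
| "prompt_polarity b (PNeg \<phi>) \<longleftrightarrow> prompt_polarity (\<not> b) \<phi>"
| "prompt_polarity b (PDisj \<phi> \<psi>) \<longleftrightarrow> prompt_polarity b \<phi> \<and> prompt_polarity b \<psi>"
| "prompt_polarity b (PNext \<phi>) \<longleftrightarrow> prompt_polarity b \<phi>"
| "prompt_polarity b (PUntil \<phi> \<psi>) \<longleftrightarrow> prompt_polarity b \<phi> \<and> prompt_polarity b \<psi>"
| "prompt_polarity b (FPrompt \<phi>) \<longleftrightarrow> b \<and> prompt_polarity b \<phi>"

abbreviation prompt_positive :: "'v prompt_cltl \<Rightarrow> bool" where
  "prompt_positive \<phi> \<equiv> prompt_polarity True \<phi>"


section \<open>Semantics\<close>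

type_synonym 'v valuation = "'v \<Rightarrow> int"
type_synonym 'v model = "nat \<Rightarrow> 'v valuation"

primrec rel_sat :: "rel \<Rightarrow> int \<Rightarrow> int \<Rightarrow> bool" where
  "rel_sat Less m n \<longleftrightarrow> m < n"
| "rel_sat Equal m n \<longleftrightarrow> m = n"

primrec constr_sat :: "'v model \<Rightarrow> nat \<Rightarrow> 'v constr \<Rightarrow> bool" where
  "constr_sat \<sigma> i (LookAhead r a x b y) \<longleftrightarrow> rel_sat r (\<sigma> (i + a) x) (\<sigma> (i + b) y)"
| "constr_sat \<sigma> i (FutureBlind r x y) \<longleftrightarrow> rel_sat r (\<sigma> i x) (\<sigma> i y)"

primrec cltl_sat :: "'v model \<Rightarrow> nat \<Rightarrow> 'v cltl \<Rightarrow> bool" where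
  "cltl_sat \<sigma> i (Constr c) \<longleftrightarrow> constr_sat \<sigma> i c"
| "cltl_sat \<sigma> i (Neg \<phi>) \<longleftrightarrow> \<not> cltl_sat \<sigma> i \<phi>"
| "cltl_sat \<sigma> i (Disj \<phi> \<psi>) \<longleftrightarrow> cltl_sat \<sigma> i \<phi> \<or> cltl_sat \<sigma> i \<psi>"
| "cltl_sat \<sigma> i (Next \<phi>) \<longleftrightarrow> cltl_sat \<sigma> (Suc i) \<phi>"
| "cltl_sat \<sigma> i (Until \<phi> \<psi>) \<longleftrightarrow>
     (\<exists>j\<ge>i. cltl_sat \<sigma> j \<psi> \<and> (\<forall>l. i \<le> l \<and> l < j \<longrightarrow> cltl_sat \<sigma> l \<phi>))"

primrec prompt_sat :: "'v model \<Rightarrow> nat \<Rightarrow> nat \<Rightarrow> 'v prompt_cltl \<Rightarrow> bool" where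
  "prompt_sat \<sigma> i k (PConstr c) \<longleftrightarrow> constr_sat \<sigma> i c"
| "prompt_sat \<sigma> i k (PNeg \<phi>) \<longleftrightarrow> \<not> prompt_sat \<sigma> i k \<phi>"
| "prompt_sat \<sigma> i k (PDisj \<phi> \<psi>) \<longleftrightarrow> prompt_sat \<sigma> i k \<phi> \<or> prompt_sat \<sigma> i k \<psi>"
| "prompt_sat \<sigma> i k (PNext \<phi>) \<longleftrightarrow> prompt_sat \<sigma> (Suc i) k \<phi>"
| "prompt_sat \<sigma> i k (PUntil \<phi> \<psi>) \<longleftrightarrow>
     (\<exists>j\<ge>i. prompt_sat \<sigma> j k \<psi> \<and> (\<forall>l. i \<le> l \<and> l < j \<longrightarrow> prompt_sat \<sigma> l k \<phi>))"
| "prompt_sat \<sigma> i k (FPrompt \<phi>) \<longleftrightarrow> (\<exists>j. i \<le> j \<and> j \<le> i + k \<and> prompt_sat \<sigma> j k \<phi>)"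


section \<open>Single-sided games\<close>

text \<open>
  Valuations of a set \<open>W\<close> of variables are elements of \<open>W \<rightarrow>\<^sub>E UNIV\<close>. With \<open>V\<close> the set of all
  variables and \<open>EV\<close> those of the environment, a strategy of the system maps the list of the
  valuations of \<open>V\<close> chosen in the previous rounds (oldest first) and the valuation of \<open>EV\<close> chosen
  in the current round to a valuation of \<open>V - EV\<close>.
\<close>

type_synonym 'v strategy = "'v valuation list \<Rightarrow> 'v valuation \<Rightarrow> 'v valuation"

definition is_strategy :: "'v set \<Rightarrow> 'v set \<Rightarrow> 'v strategy \<Rightarrow> bool" where
  "is_strategy EV V \<tau> \<longleftrightarrow>
     (\<forall>h \<in> lists (V \<rightarrow>\<^sub>E UNIV). \<forall>e \<in> EV \<rightarrow>\<^sub>E UNIV. \<tau> h e \<in> (V - EV) \<rightarrow>\<^sub>E UNIV)"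

definition consistent :: "'v set \<Rightarrow> 'v set \<Rightarrow> 'v strategy \<Rightarrow> 'v model \<Rightarrow> bool" where
  "consistent EV V \<tau> \<sigma> \<longleftrightarrow>
     (\<forall>i. \<sigma> i \<in> V \<rightarrow>\<^sub>E UNIV) \<and>
     (\<forall>i. restrict (\<sigma> i) (V - EV) = \<tau> (map \<sigma> [0..<i]) (restrict (\<sigma> i) EV))"

definition system_wins_cltl :: "'v set \<Rightarrow> 'v set \<Rightarrow> 'v cltl \<Rightarrow> bool" where
  "system_wins_cltl EV V \<phi> \<longleftrightarrow>
     (\<exists>\<tau>. is_strategy EV V \<tau> \<and> (\<forall>\<sigma>. consistent EV V \<tau> \<sigma> \<longrightarrow> cltl_sat \<sigma> 0 \<phi>))"

definition system_wins_prompt :: "'v set \<Rightarrow> 'v set \<Rightarrow> 'v prompt_cltl \<Rightarrow> bool" where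
  "system_wins_prompt EV V \<phi> \<longleftrightarrow>
     (\<exists>\<tau>. is_strategy EV V \<tau> \<and> (\<exists>k. \<forall>\<sigma>. consistent EV V \<tau> \<sigma> \<longrightarrow> prompt_sat \<sigma> 0 k \<phi>))"


section \<open>The translation\<close>

definition colour :: "'v \<Rightarrow> 'v \<Rightarrow> 'v cltl" where
  "colour xc yc = Constr (LookAhead Equal 0 xc 0 yc)"

primrec relativize :: "'v cltl \<Rightarrow> 'v prompt_cltl \<Rightarrow> 'v cltl" where
  "relativize p (PConstr c) = Constr c"
| "relativize p (PNeg \<phi>) = Neg (relativize p \<phi>)"
| "relativize p (PDisj \<phi> \<psi>) = Disj (relativize p \<phi>) (relativize p \<psi>)"
| "relativize p (PNext \<phi>) = Next (relativize p \<phi>)"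
| "relativize p (PUntil \<phi> \<psi>) = Until (relativize p \<phi>) (relativize p \<psi>)"
| "relativize p (FPrompt \<phi>) =
     Conj (Imp p (Until p (Until (Neg p) (relativize p \<phi>))))
          (Imp (Neg p) (Until (Neg p) (Until p (relativize p \<phi>))))"

definition colour_cltl :: "'v \<Rightarrow> 'v \<Rightarrow> 'v prompt_cltl \<Rightarrow> 'v cltl" where
  "colour_cltl xc yc \<phi> =
     Conj (Conj (Globally (Finally (colour xc yc))) (Globally (Finally (Neg (colour xc yc)))))
          (relativize (colour xc yc) \<phi>)"

end

(*
  Forwards, the system colours the play in alternating blocks of length k + 1.

  Backwards, a winning strategy for c(phi) need not have bounded blocks, so it is cut and pasted.
  Each history h of it gets finitely many data: the order type and the gaps of the last W values of
  the look-ahead variables, the order types of the future-blind variables, an ordinal rank for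
  each state of a tableau for c(phi), bounding how often a refutation can still make progress, and
  an ordinal rank bounding the current colour block. Domination of these data is a
  well-quasi-order, so there is a finite set M of histories dominating all histories. The new
  strategy always plays from a history in M: after each round it jumps to one that dominates the
  history just reached. Ranks never increase, so the pasted plays still satisfy c(phi), and the
  rank of a block can only take card M values. The jump keeps the order type and does not increase
  gaps, so the integers of the old play can be turned into those of the new one by a strictly
  monotone map that is revised in every round; future-blind variables keep their values, since
  they are never compared across positions.
*)

theory Submission
  imports Defs Complex_Main
begin

section \<open>Well-quasi-orders\<close>

text \<open>Stated through infinite ascending subsequences instead of a single good pair, so that
  conjunctions are handled by extracting twice, without Ramsey's theorem.\<close>

definition wqo :: "('a \<Rightarrow> 'a \<Rightarrow> bool) \<Rightarrow> bool" where
  "wqo P \<longleftrightarrow> (\<forall>f. \<exists>g::nat \<Rightarrow> nat. strict_mono g \<and> (\<forall>i j. i < j \<longrightarrow> P (f (g i)) (f (g j))))"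

text \<open>Every sequence has a monotone subsequence; a descending one reaches the least element of
  its range and is constant from there on.\<close>

lemma wqo_le:
  fixes f :: "'a \<Rightarrow> 'o::wellorder"
  shows "wqo (\<lambda>x y. f x \<le> f y)"
  unfolding wqo_def
proof
  fix s :: "nat \<Rightarrow> 'a"
  obtain g :: "nat \<Rightarrow> nat" where g: "strict_mono g" and mono: "monoseq (\<lambda>n. f (s (g n)))"
    using seq_monosub[of "\<lambda>n. f (s n)"] by auto
  show "\<exists>g::nat \<Rightarrow> nat. strict_mono g \<and> (\<forall>i j. i < j \<longrightarrow> f (s (g i)) \<le> f (s (g j)))"
  proof (cases "\<forall>i j. i \<le> j \<longrightarrow> f (s (g i)) \<le> f (s (g j))")
    case True
    then show ?thesis
      using g by (meson less_imp_le)
  next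
    case False
    then have decr: "f (s (g j)) \<le> f (s (g i))" if "i \<le> j" for i j
      using mono that unfolding monoseq_def by blast
    define v where "v = (LEAST x. x \<in> range (\<lambda>n. f (s (g n))))"
    have "v \<in> range (\<lambda>n. f (s (g n)))"
      unfolding v_def by (rule LeastI) blast
    then obtain k where k: "f (s (g k)) = v"
      by auto
    have "v \<le> f (s (g i))" for i
      unfolding v_def by (rule Least_le) blast
    then have "f (s (g (k + i))) = v" for i
      using decr[of k "k + i"] k by (simp add: antisym)
    moreover have "strict_mono (\<lambda>i. g (k + i))"
      using g by (simp add: strict_mono_def)
    ultimately show ?thesis
      by (intro exI[of _ "\<lambda>i. g (k + i)"]) auto
  qed
qed

lemma wqo_conj:
  assumes "wqo P" "wqo Q"
  shows "wqo (\<lambda>x y. P x y \<and> Q x y)"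
  unfolding wqo_def
proof
  fix f :: "nat \<Rightarrow> 'a"
  obtain g :: "nat \<Rightarrow> nat" where g: "strict_mono g" "\<And>i j. i < j \<Longrightarrow> P (f (g i)) (f (g j))"
    using assms(1) unfolding wqo_def by blast
  obtain h :: "nat \<Rightarrow> nat" where h: "strict_mono h" "\<And>i j. i < j \<Longrightarrow> Q (f (g (h i))) (f (g (h j)))"
    using assms(2) unfolding wqo_def by (elim allE[of _ "\<lambda>i. f (g i)"]) blast
  show "\<exists>g::nat \<Rightarrow> nat. strict_mono g \<and> (\<forall>i j. i < j \<longrightarrow> P (f (g i)) (f (g j)) \<and> Q (f (g i)) (f (g j)))"
    using g h by (intro exI[of _ "\<lambda>i. g (h i)"]) (simp add: strict_mono_def)
qed

lemma wqo_mono: "wqo P \<Longrightarrow> (\<And>x y. P x y \<Longrightarrow> Q x y) \<Longrightarrow> wqo Q"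
  unfolding wqo_def by meson

lemma wqo_Ball:
  assumes "finite S" "\<And>s. s \<in> S \<Longrightarrow> wqo (P s)"
  shows "wqo (\<lambda>x y. \<forall>s\<in>S. P s x y)"
  using assms
proof (induction S rule: finite_induct)
  case empty
  then show ?case
    unfolding wqo_def using strict_mono_id by blast
next
  case (insert s S)
  then show ?case
    using wqo_conj[of "P s" "\<lambda>x y. \<forall>s\<in>S. P s x y"] by simp
qed

text \<open>Equality of truth values is an inequality for \<open>p\<close> together with one for its
  negation, both read as numbers.\<close>

lemma wqo_bool_eq: "wqo (\<lambda>x y. p x = (p y :: bool))"
proof -
  have "wqo (\<lambda>x y. (of_bool (p x) :: nat) \<le> of_bool (p y) \<and> (of_bool (\<not> p x) :: nat) \<le> of_bool (\<not> p y))"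
    by (intro wqo_conj wqo_le)
  then show ?thesis
    by (rule wqo_mono) (auto simp: of_bool_def split: if_splits)
qed

text \<open>Without a finite basis, dependent choice builds a sequence in which no earlier element
  is related to a later one, so no subsequence can ascend.\<close>

lemma wqo_finite_basis:
  assumes "wqo P"
  shows "\<exists>M. finite M \<and> M \<subseteq> X \<and> (\<forall>x\<in>X. \<exists>m\<in>M. P m x)"
proof (rule ccontr)
  assume none: "\<not> ?thesis"
  have ex: "\<exists>x\<in>X. \<forall>m\<in>M. \<not> P m x" if M: "finite M" "M \<subseteq> X" for M
  proof (rule ccontr)
    assume "\<not> (\<exists>x\<in>X. \<forall>m\<in>M. \<not> P m x)"
    then have "\<forall>x\<in>X. \<exists>m\<in>M. P m x"
      by simp
    then show False
      using M none[unfolded not_ex, THEN spec, of M] by simp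
  qed
  have "\<exists>f. \<forall>n::nat. f n \<in> X \<and> (\<forall>i<n. \<not> P (f i) (f n))"
  proof (rule dependent_wellorder_choice[where P = "\<lambda>f n x. x \<in> X \<and> (\<forall>i<n. \<not> P (f i) x)"])
    fix n :: nat and f
    assume "\<And>i. i < n \<Longrightarrow> f i \<in> X \<and> (\<forall>k<i. \<not> P (f k) (f i))"
    then have "f ` {..<n} \<subseteq> X"
      by blast
    then obtain x where "x \<in> X" "\<forall>m\<in>f ` {..<n}. \<not> P m x"
      using ex[of "f ` {..<n}"] by auto
    then show "\<exists>x. x \<in> X \<and> (\<forall>i<n. \<not> P (f i) x)"
      by blast
  next
    fix r :: 'a and f g :: "nat \<Rightarrow> 'a" and n :: nat
    assume "\<And>y. y < n \<Longrightarrow> f y = g y"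
    then have "(\<forall>i<n. \<not> P (f i) r) \<longleftrightarrow> (\<forall>i<n. \<not> P (g i) r)"
      by metis
    then show "(r \<in> X \<and> (\<forall>i<n. \<not> P (f i) r)) = (r \<in> X \<and> (\<forall>i<n. \<not> P (g i) r))"
      by blast
  qed
  then obtain f :: "nat \<Rightarrow> 'a" where f: "\<And>i n. i < n \<Longrightarrow> \<not> P (f i) (f n)"
    by blast
  obtain g :: "nat \<Rightarrow> nat" where "strict_mono g" and g: "\<And>i j. i < j \<Longrightarrow> P (f (g i)) (f (g j))"
    using assms[unfolded wqo_def, THEN spec, of f] by blast
  then have "g 0 < g 1"
    by (simp add: strict_mono_def)
  then show False
    using f[of "g 0" "g 1"] g[of 0 1] by simp
qed


section \<open>Ranks of transition systems\<close>

text \<open>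
  Ordinals are taken from a well-order on \<open>'a set\<close>: by Cantor's theorem no map from \<open>'a\<close> exhausts
  it, so a least unused rank always exists.
\<close>

typedef 'a rank = "UNIV :: 'a set set"
  by simp

definition rank_order :: "('a rank \<times> 'a rank) set" where
  "rank_order = (SOME r. Well_order r \<and> Field r = UNIV)"

lemma rank_order: "Well_order (rank_order :: ('a rank \<times> 'a rank) set)" "Field (rank_order :: ('a rank \<times> 'a rank) set) = UNIV"
  using someI_ex[OF well_ordering[where 'a = "'a rank"]] unfolding rank_order_def by auto

instantiation rank :: (type) wellorder
begin

definition less_eq_rank :: "'a rank \<Rightarrow> 'a rank \<Rightarrow> bool" where
  "x \<le> y \<longleftrightarrow> (x, y) \<in> rank_order"

definition less_rank :: "'a rank \<Rightarrow> 'a rank \<Rightarrow> bool" where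
  "x < y \<longleftrightarrow> (x, y) \<in> rank_order - Id"

instance
proof
  have r: "refl (rank_order :: ('a rank \<times> 'a rank) set)" "trans (rank_order :: ('a rank \<times> 'a rank) set)"
      "antisym (rank_order :: ('a rank \<times> 'a rank) set)" "total (rank_order :: ('a rank \<times> 'a rank) set)"
      "wf (rank_order - Id :: ('a rank \<times> 'a rank) set)"
    using rank_order(1)[where 'a = 'a] rank_order(2)[where 'a = 'a]
    unfolding well_order_on_def linear_order_on_def partial_order_on_def preorder_on_def by auto
  fix x y z :: "'a rank"
  show "x < y \<longleftrightarrow> x \<le> y \<and> \<not> y \<le> x"
    unfolding less_rank_def less_eq_rank_def using r(3) by (auto dest: antisymD)
  show "x \<le> x"
    unfolding less_eq_rank_def using r(1) by (auto dest: refl_onD)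
  show "x \<le> y \<Longrightarrow> y \<le> z \<Longrightarrow> x \<le> z"
    unfolding less_eq_rank_def using r(2) by (blast dest: transD)
  show "x \<le> y \<Longrightarrow> y \<le> x \<Longrightarrow> x = y"
    unfolding less_eq_rank_def using r(3) by (blast dest: antisymD)
  show "x \<le> y \<or> y \<le> x"
    unfolding less_eq_rank_def using r(1,4) by (cases "x = y") (auto simp: total_on_def dest: refl_onD)
  fix P and a :: "'a rank"
  assume "\<And>x :: 'a rank. (\<And>y. y < x \<Longrightarrow> P y) \<Longrightarrow> P x"
  then show "P a"
    unfolding less_rank_def using wf_induct_rule[OF r(5), of P a] by blast
qed

end

lemma rank_unused: "\<exists>x::'a rank. x \<notin> f ` (A :: 'a set)"
proof (rule ccontr)
  assume *: "\<nexists>x::'a rank. x \<notin> f ` A"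
  have "\<exists>a. Rep_rank (f a) = S" for S
    using * Abs_rank_inverse[of S] by (metis UNIV_I image_iff)
  then have "surj (\<lambda>a. Rep_rank (f a))"
    by (metis surjI)
  then show False
    by (metis Cantors_theorem Pow_UNIV)
qed

text \<open>By well-founded recursion, \<open>rk v\<close> is the least rank not taken by a
  predecessor of \<open>v\<close>. More predecessors exclude more ranks, so ranks grow with the set
  of predecessors. Transitivity gives growth along \<open>R\<close>, which is strict because
  \<open>rk v\<close> differs from the rank of each predecessor.\<close>

lemma wfp_transp_rank:
  fixes R :: "'a \<Rightarrow> 'a \<Rightarrow> bool"
  assumes "wfp R" "transp R"
  obtains rk :: "'a \<Rightarrow> 'a rank"
  where "\<And>u v. R u v \<Longrightarrow> rk u < rk v"
    and "\<And>v w. (\<And>u. R u v \<Longrightarrow> R u w) \<Longrightarrow> rk v \<le> rk w"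
proof -
  define rk :: "'a \<Rightarrow> 'a rank"
    where "rk = wfrec {(u, v). R u v} (\<lambda>g v. LEAST x. x \<notin> g ` {u. R u v})"
  have wf: "wf {(u, v). R u v}"
    using assms(1) by (simp add: wfp_def)
  have rk: "rk v = (LEAST x. x \<notin> rk ` {u. R u v})" for v
  proof -
    have "cut rk {(u, v). R u v} v ` {u. R u v} = rk ` {u. R u v}"
      by (auto simp: cut_def)
    then show ?thesis
      unfolding rk_def by (subst wfrec[OF wf]) simp
  qed
  have unused: "rk v \<notin> rk ` {u. R u v}" for v
    unfolding rk[of v] by (rule LeastI_ex) (rule rank_unused)
  have mono: "rk v \<le> rk w" if "\<And>u. R u v \<Longrightarrow> R u w" for v w
    unfolding rk[of v] by (rule Least_le) (use unused[of w] that in auto)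
  have "rk u < rk v" if uv: "R u v" for u v
  proof -
    have "rk u \<le> rk v"
      by (rule mono) (use uv assms(2) in \<open>blast dest: transpD\<close>)
    moreover have "rk u \<noteq> rk v"
      using unused[of v] uv by (metis imageI mem_Collect_eq)
    ultimately show ?thesis
      by simp
  qed
  then show ?thesis
    using that mono by blast
qed

section \<open>Runs with infinitely many bad steps\<close>

definition next_bad :: "('s \<Rightarrow> 's \<Rightarrow> bool) \<Rightarrow> ('s \<Rightarrow> 's \<Rightarrow> bool) \<Rightarrow> 's \<Rightarrow> 's \<Rightarrow> bool" where
  "next_bad step bad u v \<longleftrightarrow> (\<exists>w. step\<^sup>*\<^sup>* v w \<and> bad w u)"

text \<open>From a state that is not accessible, some bad step ahead leads to another such state.
  The run follows a shortest path to such a step: the distance \<open>d\<close> drops until a bad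
  step is taken, so bad steps recur forever.\<close>

lemma not_accp_infinite_run:
  assumes "\<not> Wellfounded.accp (next_bad step bad) s" and sub: "\<And>u v. bad u v \<Longrightarrow> step u v"
  obtains f :: "nat \<Rightarrow> 's" where "f 0 = s" "\<And>i. step (f i) (f (Suc i))"
    "\<And>i. \<exists>j\<ge>i. bad (f j) (f (Suc j))"
proof -
  define N where "N s \<longleftrightarrow> \<not> Wellfounded.accp (next_bad step bad) s" for s
  define D where "D s n \<longleftrightarrow> (\<exists>w u. (step ^^ n) s w \<and> bad w u \<and> N u)" for s n
  define d where "d s = (LEAST n. D s n)" for s
  have N_pred: "N s" if "step\<^sup>*\<^sup>* s w" "bad w u" "N u" for s w u
  proof -
    have "next_bad step bad u s"
      using that(1,2) unfolding next_bad_def by blast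
    then show ?thesis
      using that(3) accp_downward unfolding N_def by fast
  qed
  have D_ex: "\<exists>n. D s n" if N: "N s" for s
  proof -
    obtain u where u: "next_bad step bad u s" "N u"
      using not_accp_down[OF N[unfolded N_def]] unfolding N_def by blast
    then obtain w where w: "step\<^sup>*\<^sup>* s w" "bad w u"
      unfolding next_bad_def by blast
    then obtain n where "(step ^^ n) s w"
      using rtranclp_imp_relpowp by fast
    then show ?thesis
      unfolding D_def using w(2) u(2) by blast
  qed
  have succ: "\<exists>s'. N s' \<and> step s s' \<and> (bad s s' \<or> d s' < d s)" if N: "N s" for s
  proof -
    have "D s (d s)"
      unfolding d_def using D_ex[OF N] by (rule LeastI_ex)
    then obtain w u where wu: "(step ^^ d s) s w" "bad w u" "N u"
      unfolding D_def by blast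
    show ?thesis
    proof (cases "d s")
      case 0
      then show ?thesis
        using wu sub by auto
    next
      case (Suc n)
      then obtain s' where s': "step s s'" "(step ^^ n) s' w"
        using wu(1) relpowp_Suc_D2[of n step s w] by auto
      have "d s' \<le> n"
        unfolding d_def by (rule Least_le) (use s' wu in \<open>auto simp: D_def\<close>)
      moreover have "N s'"
        using N_pred[OF relpowp_imp_rtranclp[OF s'(2)] wu(2,3)] .
      ultimately show ?thesis
        using s'(1) Suc by (intro exI[of _ s']) simp
    qed
  qed
  have "\<exists>f. \<forall>i::nat. (N (f i) \<and> (i = 0 \<longrightarrow> f i = s)) \<and>
      step (f i) (f (Suc i)) \<and> (bad (f i) (f (Suc i)) \<or> d (f (Suc i)) < d (f i))"
  proof (rule dependent_nat_choice)
    show "\<exists>x. N x \<and> (0 = (0::nat) \<longrightarrow> x = s)"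
      using assms(1) unfolding N_def by blast
  next
    fix x and i :: nat
    assume "N x \<and> (i = 0 \<longrightarrow> x = s)"
    then show "\<exists>y. (N y \<and> (Suc i = 0 \<longrightarrow> y = s)) \<and> step x y \<and> (bad x y \<or> d y < d x)"
      using succ[of x] by auto
  qed
  then obtain f where f: "f 0 = s" "\<And>i. step (f i) (f (Suc i))"
      "\<And>i. bad (f i) (f (Suc i)) \<or> d (f (Suc i)) < d (f i)"
    by blast
  have "\<exists>j\<ge>i. bad (f j) (f (Suc j))" for i
  proof (rule ccontr)
    assume "\<not> (\<exists>j\<ge>i. bad (f j) (f (Suc j)))"
    then have dec: "d (f (Suc (i + k))) < d (f (i + k))" for k
      using f(3)[of "i + k"] by auto
    have "d (f (i + k)) + k \<le> d (f i)" for k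
    proof (induction k)
      case (Suc k)
      then show ?case
        using dec[of k] by simp
    qed simp
    from this[of "Suc (d (f i))"] show False
      by simp
  qed
  then show ?thesis
    using that f(1,2) by blast
qed

text \<open>
  From a state in \<open>F\<close> every run takes only finitely many bad steps; the states outside \<open>F\<close> share a
  rank above all ranks of states in \<open>F\<close>.
\<close>

lemma rank_exists:
  fixes step bad :: "'s \<Rightarrow> 's \<Rightarrow> bool"
  assumes sub: "\<And>u v. bad u v \<Longrightarrow> step u v"
  obtains rk :: "'s \<Rightarrow> 's rank" and F
  where "\<And>s s'. step s s' \<Longrightarrow> rk s' \<le> rk s"
    and "\<And>s s'. bad s s' \<Longrightarrow> s \<in> F \<Longrightarrow> rk s' < rk s"
    and "\<And>s s'. s \<in> F \<Longrightarrow> rk s' \<le> rk s \<Longrightarrow> s' \<in> F"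
    and "\<And>s. s \<notin> F \<Longrightarrow> \<exists>f. f 0 = s \<and> (\<forall>i::nat. step (f i) (f (Suc i))) \<and>
           (\<forall>i. \<exists>j\<ge>i. bad (f j) (f (Suc j)))"
proof -
  define B where "B = next_bad step bad"
  define F where "F = {s. Wellfounded.accp B s}"
  \<comment> \<open>\<open>B\<close> is well-founded only on \<open>F\<close>. Placing all of
    \<open>F\<close> below the other states, which get no further predecessors, makes
    \<open>R\<close> well-founded everywhere and lets membership in \<open>F\<close> be inherited by
    states of smaller or equal rank.\<close>
  define R where "R u v \<longleftrightarrow> (v \<in> F \<and> B u v) \<or> (u \<in> F \<and> v \<notin> F)" for u v
  have B_step: "B u v" if "step\<^sup>*\<^sup>* v w" "B u w" for u v w
    using that rtranclp_trans[of step v w] unfolding B_def next_bad_def by blast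
  have B_trans: "B u w" if uv: "B u v" and vw: "B v w" for u v w
  proof -
    obtain z where z: "step\<^sup>*\<^sup>* w z" "bad z v"
      using vw unfolding B_def next_bad_def by blast
    then have "step\<^sup>*\<^sup>* w v"
      using sub by (meson rtranclp.rtrancl_into_rtrancl)
    then show ?thesis
      using B_step uv by blast
  qed
  have F_B: "u \<in> F" if "v \<in> F" "B u v" for u v
    using that accp_downward[of B v u] unfolding F_def by simp
  have F_step: "v \<in> F" if uv: "u \<in> F" "step u v" for u v
  proof -
    have "Wellfounded.accp B w" if "B w v" for w
      using F_B[OF uv(1)] B_step[of u v w] uv(2) that unfolding F_def by auto
    then show ?thesis
      unfolding F_def by (simp add: accp.accI)
  qed
  have acc_R: "Wellfounded.accp R v" if "v \<in> F" for v
    using that[unfolded F_def mem_Collect_eq]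
  proof (rule accp_induct)
    fix x
    assume "Wellfounded.accp B x" "\<forall>y. B y x \<longrightarrow> Wellfounded.accp R y"
    then have "Wellfounded.accp R y" if "R y x" for y
      using that unfolding R_def F_def by blast
    then show "Wellfounded.accp R x"
      by (rule accp.accI)
  qed
  have "Wellfounded.accp R v" for v
  proof (cases "v \<in> F")
    case False
    then have "Wellfounded.accp R u" if "R u v" for u
      using that acc_R[of u] unfolding R_def by blast
    then show ?thesis
      by (rule accp.accI)
  qed (rule acc_R)
  then have "wfp R"
    by (intro accp_wfpI allI)
  moreover have "transp R"
    unfolding R_def by (rule transpI) (use B_trans F_B in blast)
  ultimately obtain rk :: "'s \<Rightarrow> 's rank" where rk: "\<And>u v. R u v \<Longrightarrow> rk u < rk v"
      "\<And>v w. (\<And>u. R u v \<Longrightarrow> R u w) \<Longrightarrow> rk v \<le> rk w"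
    using wfp_transp_rank[of R] by metis
  show ?thesis
  proof (rule that[of rk F])
    fix s s'
    \<comment> \<open>A plain step need not be a pair of \<open>R\<close>. It only shrinks the set
      of \<open>R\<close>-predecessors, so the second property of the rank is used.\<close>
    show "rk s' \<le> rk s" if "step s s'"
    proof (rule rk(2))
      fix u assume "R u s'"
      then show "R u s"
        unfolding R_def using that F_step[of s s'] F_B[of s' u] B_step[of s s' u] by blast
    qed
    show "rk s' < rk s" if "bad s s'" "s \<in> F"
      by (rule rk(1)) (use that in \<open>auto simp: R_def B_def next_bad_def\<close>)
    show "s' \<in> F" if "s \<in> F" "rk s' \<le> rk s"
      using rk(1)[of s s'] that unfolding R_def by (meson leD)
    show "\<exists>f. f 0 = s \<and> (\<forall>i::nat. step (f i) (f (Suc i))) \<and> (\<forall>i. \<exists>j\<ge>i. bad (f j) (f (Suc j)))"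
      if "s \<notin> F"
      by (rule not_accp_infinite_run[of step bad s]) (use that sub in \<open>auto simp: F_def B_def\<close>)
  qed
qed

lemma no_infinite_rank_descent:
  fixes r :: "nat \<Rightarrow> 'o::wellorder"
  assumes "\<And>i. r (Suc i) \<le> r i" and "\<And>i. \<exists>j\<ge>i. r (Suc j) < r j"
  shows False
proof -
  have "\<exists>k. (LEAST x. x \<in> range r) = r k"
    by (metis (mono_tags, lifting) LeastI_ex rangeE rangeI)
  then obtain k where k: "(LEAST x. x \<in> range r) = r k"
    by blast
  obtain j where j: "j \<ge> k" "r (Suc j) < r j"
    using assms(2) by blast
  have "r j \<le> r k"
    using lift_Suc_antimono_le[of r, OF assms(1) j(1)] .
  moreover have "r k \<le> r (Suc j)"
    unfolding k[symmetric] by (rule Least_le) blast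
  ultimately show False
    using j(2) by simp
qed


section \<open>Strictly monotone relabellings\<close>

text \<open>Each unit step adds at least 1, so a strictly monotone map of the integers never shrinks
  a gap.\<close>

lemma strict_mono_int_diff:
  fixes F :: "int \<Rightarrow> int"
  assumes "strict_mono F" "x \<le> y"
  shows "y - x \<le> F y - F x"
  using assms(2)
proof (induction y rule: int_ge_induct)
  case (step y)
  then show ?case
    using strict_monoD[OF assms(1), of y "y + 1"] by simp
qed simp

text \<open>
  Gaps may shrink from \<open>u\<close> to \<open>v\<close>: the witness is a maximum of piecewise linear functions, one per
  point \<open>p\<close>, with slope 1 above \<open>v p\<close> and a steep slope \<open>B\<close> below it.
\<close>

lemma strict_mono_relabel:
  fixes F :: "int \<Rightarrow> int" and u v :: "'p \<Rightarrow> int"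
  assumes F: "strict_mono F" and fin: "finite P"
    and order: "\<And>p q. p \<in> P \<Longrightarrow> q \<in> P \<Longrightarrow> v p \<le> v q \<longleftrightarrow> u p \<le> u q"
    and gap: "\<And>p q. p \<in> P \<Longrightarrow> q \<in> P \<Longrightarrow> v p \<le> v q \<Longrightarrow> v q - v p \<le> u q - u p"
  shows "\<exists>G :: int \<Rightarrow> int. strict_mono G \<and> (\<forall>p\<in>P. G (v p) = F (u p))"
proof (cases "P = {}")
  case True
  then show ?thesis
    using F by blast
next
  case False
  \<comment> \<open>The largest difference between two target values: with slope
    \<open>B + 1\<close>, a piece lies below every target as soon as it is one unit left of its own
    point.\<close>
  define B where "B = Max ((\<lambda>(p, q). F (u p) - F (u q)) ` (P \<times> P))"
  have B: "F (u p) - F (u q) \<le> B" if "p \<in> P" "q \<in> P" for p q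
    unfolding B_def by (rule Max_ge) (use fin that in auto)
  have B0: "0 \<le> B"
    using B False by force
  define g where "g p z = (if v p \<le> z then F (u p) + (z - v p) else F (u p) - (B + 1) * (v p - z))"
    for p z
  define G where "G z = Max ((\<lambda>p. g p z) ` P)" for z
  have g_mono: "g p y < g p z" if "y < z" for p y z
  proof -
    have "(B + 1) * (v p - z) < (B + 1) * (v p - y)"
      using that B0 by (simp add: mult_strict_left_mono)
    moreover have "0 < (B + 1) * (v p - y)" if "y < v p"
      using that B0 by simp
    ultimately show ?thesis
      using that unfolding g_def by auto
  qed
  have "strict_mono G"
  proof (rule strict_monoI)
    fix y z :: int
    assume "y < z"
    have "G y \<in> (\<lambda>p. g p y) ` P"
      unfolding G_def by (rule Max_in) (use fin False in auto)
    then obtain p where p: "p \<in> P" "G y = g p y"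
      by auto
    then have "G y < g p z"
      using g_mono[OF \<open>y < z\<close>] by simp
    also have "\<dots> \<le> G z"
      unfolding G_def by (rule Max_ge) (use fin p in auto)
    finally show "G y < G z" .
  qed
  moreover have "G (v q) = F (u q)" if q: "q \<in> P" for q
    unfolding G_def
  proof (rule Max_eqI)
    show "F (u q) \<in> (\<lambda>p. g p (v q)) ` P"
      using q by (auto simp: g_def intro!: image_eqI[of _ _ q])
    fix y assume "y \<in> (\<lambda>p. g p (v q)) ` P"
    then obtain p where p: "p \<in> P" "y = g p (v q)"
      by auto
    show "y \<le> F (u q)"
    proof (cases "v p \<le> v q")
      case True
      \<comment> \<open>Right of its own point a piece climbs with slope 1, hence by at most the gap
        of \<open>u\<close>, which \<open>F\<close> does not shrink.\<close>
      then have "v q - v p \<le> F (u q) - F (u p)"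
        using gap[OF p(1) q] order[OF p(1) q] strict_mono_int_diff[OF F, of "u p" "u q"] by simp
      then show ?thesis
        using p True by (simp add: g_def)
    next
      case False
      have "(B + 1) * 1 \<le> (B + 1) * (v p - v q)"
        by (rule mult_left_mono) (use False B0 in auto)
      then show ?thesis
        using p False B[OF p(1) q] by (simp add: g_def)
    qed
  qed (use fin in simp)
  ultimately show ?thesis
    by blast
qed


section \<open>Tableaux\<close>

primrec sub :: "'v cltl \<Rightarrow> 'v cltl set" where
  "sub (Constr c) = {Constr c}"
| "sub (Neg \<phi>) = insert (Neg \<phi>) (sub \<phi>)"
| "sub (Disj \<phi> \<psi>) = insert (Disj \<phi> \<psi>) (sub \<phi> \<union> sub \<psi>)"
| "sub (Next \<phi>) = insert (Next \<phi>) (sub \<phi>)"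
| "sub (Until \<phi> \<psi>) = insert (Until \<phi> \<psi>) (sub \<phi> \<union> sub \<psi>)"

lemma finite_sub: "finite (sub \<phi>)"
  by (induction \<phi>) auto

lemma sub_self: "\<phi> \<in> sub \<phi>"
  by (cases \<phi>) auto

lemma sub_trans: "\<chi> \<in> sub \<phi> \<Longrightarrow> sub \<chi> \<subseteq> sub \<phi>"
  by (induction \<phi>) auto

section \<open>Shifting and padding models\<close>

lemma Constr_in_sub_Next: "Constr c \<in> sub ((Next ^^ n) \<phi>) \<longleftrightarrow> Constr c \<in> sub \<phi>"
  by (induction n) auto

lemma constr_sat_shift: "constr_sat (\<lambda>j. \<sigma> (j + n)) i c \<longleftrightarrow> constr_sat \<sigma> (i + n) c"
  by (cases c) (auto simp: ac_simps)

lemma cltl_sat_shift: "cltl_sat (\<lambda>j. \<sigma> (j + n)) i \<phi> \<longleftrightarrow> cltl_sat \<sigma> (i + n) \<phi>"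
proof (induction \<phi> arbitrary: i)
  case (Until \<phi> \<psi>)
  have "(\<exists>j\<ge>i. cltl_sat \<sigma> (j + n) \<psi> \<and> (\<forall>l. i \<le> l \<and> l < j \<longrightarrow> cltl_sat \<sigma> (l + n) \<phi>)) \<longleftrightarrow>
    (\<exists>j\<ge>i + n. cltl_sat \<sigma> j \<psi> \<and> (\<forall>l. i + n \<le> l \<and> l < j \<longrightarrow> cltl_sat \<sigma> l \<phi>))" (is "?L \<longleftrightarrow> ?R")
  proof
    assume ?L
    then obtain j where j: "j \<ge> i" "cltl_sat \<sigma> (j + n) \<psi>"
        "\<And>l. i \<le> l \<Longrightarrow> l < j \<Longrightarrow> cltl_sat \<sigma> (l + n) \<phi>"
      by blast
    have "cltl_sat \<sigma> l \<phi>" if "i + n \<le> l" "l < j + n" for l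
      using j(3)[of "l - n"] that by simp
    then show ?R
      using j(1,2) by (intro exI[of _ "j + n"]) auto
  next
    assume ?R
    then obtain j where j: "j \<ge> i + n" "cltl_sat \<sigma> j \<psi>"
        "\<And>l. i + n \<le> l \<Longrightarrow> l < j \<Longrightarrow> cltl_sat \<sigma> l \<phi>"
      by blast
    then show ?L
      by (intro exI[of _ "j - n"]) auto
  qed
  then show ?case
    using Until by simp
qed (simp_all add: constr_sat_shift)

lemma cltl_sat_Next_funpow: "cltl_sat \<sigma> i ((Next ^^ n) \<phi>) \<longleftrightarrow> cltl_sat \<sigma> (i + n) \<phi>"
  by (induction n arbitrary: i) auto

text \<open>The zero valuations in front delay the play by \<open>W\<close>. A constraint of width
  at most \<open>W\<close> at padded position \<open>n\<close> then concerns only rounds before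
  \<open>n\<close>, so the history decides it.\<close>

definition pad :: "nat \<Rightarrow> 'v model \<Rightarrow> 'v model" where
  "pad W \<sigma> j = (if j < W then (\<lambda>_. 0) else \<sigma> (j - W))"

lemma cltl_sat_pad: "cltl_sat (pad W \<sigma>) 0 ((Next ^^ W) \<phi>) \<longleftrightarrow> cltl_sat \<sigma> 0 \<phi>"
  using cltl_sat_shift[of "pad W \<sigma>" W 0 \<phi>] by (simp add: cltl_sat_Next_funpow pad_def)

section \<open>Tableau runs and their fairness\<close>

primrec expand :: "('v constr \<Rightarrow> bool) \<Rightarrow> 'v cltl set \<Rightarrow> 'v cltl set \<Rightarrow> 'v cltl \<Rightarrow> bool" where
  "expand L A A' (Constr c) \<longleftrightarrow> L c"
| "expand L A A' (Neg \<phi>) \<longleftrightarrow> \<phi> \<notin> A"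
| "expand L A A' (Disj \<phi> \<psi>) \<longleftrightarrow> \<phi> \<in> A \<or> \<psi> \<in> A"
| "expand L A A' (Next \<phi>) \<longleftrightarrow> \<phi> \<in> A'"
| "expand L A A' (Until \<phi> \<psi>) \<longleftrightarrow> \<psi> \<in> A \<or> \<phi> \<in> A \<and> Until \<phi> \<psi> \<in> A'"

text \<open>\<open>A\<close> and \<open>A'\<close> guess the formulas true at the current and the
  next position, and \<open>L\<close> tells which constraints hold now. Requiring an equivalence
  makes \<open>A\<close> decide every formula of \<open>cl\<close>.\<close>

definition tableau :: "'v cltl set \<Rightarrow> ('v constr \<Rightarrow> bool) \<Rightarrow> 'v cltl set \<Rightarrow> 'v cltl set \<Rightarrow> bool" where
  "tableau cl L A A' \<longleftrightarrow> (\<forall>\<chi>\<in>cl. \<chi> \<in> A \<longleftrightarrow> expand L A A' \<chi>)"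

text \<open>The acceptance condition of a generalised Buechi automaton: an Until-formula is either
  not promised or redeemed at once, and all other formulas are fulfilled trivially.\<close>

definition fulfilled :: "'v cltl set \<Rightarrow> 'v cltl \<Rightarrow> bool" where
  "fulfilled A \<chi> \<longleftrightarrow> (\<forall>\<phi> \<psi>. \<chi> = Until \<phi> \<psi> \<longrightarrow> \<chi> \<in> A \<longrightarrow> \<psi> \<in> A)"

lemma Until_unfold:
  "cltl_sat \<sigma> i (Until \<phi> \<psi>) \<longleftrightarrow> cltl_sat \<sigma> i \<psi> \<or> cltl_sat \<sigma> i \<phi> \<and> cltl_sat \<sigma> (Suc i) (Until \<phi> \<psi>)"
proof
  assume "cltl_sat \<sigma> i (Until \<phi> \<psi>)"
  then obtain j where j: "j \<ge> i" "cltl_sat \<sigma> j \<psi>" "\<And>l. i \<le> l \<Longrightarrow> l < j \<Longrightarrow> cltl_sat \<sigma> l \<phi>"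
    by auto
  show "cltl_sat \<sigma> i \<psi> \<or> cltl_sat \<sigma> i \<phi> \<and> cltl_sat \<sigma> (Suc i) (Until \<phi> \<psi>)"
  proof (cases "j = i")
    case False
    then have "cltl_sat \<sigma> i \<phi>" "Suc i \<le> j"
      using j by simp_all
    moreover have "cltl_sat \<sigma> (Suc i) (Until \<phi> \<psi>)"
      using j \<open>Suc i \<le> j\<close> by auto
    ultimately show ?thesis
      by blast
  qed (use j in simp)
next
  assume "cltl_sat \<sigma> i \<psi> \<or> cltl_sat \<sigma> i \<phi> \<and> cltl_sat \<sigma> (Suc i) (Until \<phi> \<psi>)"
  then show "cltl_sat \<sigma> i (Until \<phi> \<psi>)"
  proof
    assume "cltl_sat \<sigma> i \<phi> \<and> cltl_sat \<sigma> (Suc i) (Until \<phi> \<psi>)"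
    then obtain j where j: "j \<ge> Suc i" "cltl_sat \<sigma> i \<phi>" "cltl_sat \<sigma> j \<psi>"
        "\<And>l. Suc i \<le> l \<Longrightarrow> l < j \<Longrightarrow> cltl_sat \<sigma> l \<phi>"
      by auto
    then have "cltl_sat \<sigma> l \<phi>" if "i \<le> l" "l < j" for l
      using that by (cases "l = i") auto
    then show ?thesis
      using j by (auto intro!: exI[of _ j])
  qed auto
qed

text \<open>Local consistency determines the guesses by induction on formulas, except that an
  Until-formula could be promised forever; fairness rules this out.\<close>

lemma tableau_truth:
  assumes tab: "\<And>i. tableau cl (constr_sat \<sigma> i) (A i) (A (Suc i))"
    and fair: "\<And>i \<chi>. \<chi> \<in> cl \<Longrightarrow> \<exists>j\<ge>i. fulfilled (A j) \<chi>"
    and "sub \<chi> \<subseteq> cl"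
  shows "\<chi> \<in> A i \<longleftrightarrow> cltl_sat \<sigma> i \<chi>"
proof -
  have step: "\<chi> \<in> A i \<longleftrightarrow> expand (constr_sat \<sigma> i) (A i) (A (Suc i)) \<chi>" if "\<chi> \<in> cl" for \<chi> i
    using tab[of i] that unfolding tableau_def by blast
  show ?thesis
    using assms(3)
  proof (induction \<chi> arbitrary: i)
    case (Until \<phi> \<psi>)
    have cl: "Until \<phi> \<psi> \<in> cl"
      using Until.prems by simp
    have \<phi>: "\<phi> \<in> A l \<longleftrightarrow> cltl_sat \<sigma> l \<phi>" and \<psi>: "\<psi> \<in> A l \<longleftrightarrow> cltl_sat \<sigma> l \<psi>" for l
      using Until by auto
    have unfold: "Until \<phi> \<psi> \<in> A l \<longleftrightarrow> \<psi> \<in> A l \<or> \<phi> \<in> A l \<and> Until \<phi> \<psi> \<in> A (Suc l)" for l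
      using step[OF cl, of l] by simp
    show ?case
    proof
      assume in_A: "Until \<phi> \<psi> \<in> A i"
      \<comment> \<open>If the right-hand side never came, the promise would be passed on forever
        and never be fulfilled.\<close>
      have "\<exists>j\<ge>i. \<psi> \<in> A j"
      proof (rule ccontr)
        assume none: "\<not> (\<exists>j\<ge>i. \<psi> \<in> A j)"
        have "Until \<phi> \<psi> \<in> A (i + k)" for k
        proof (induction k)
          case (Suc k)
          then show ?case
            using none unfold[of "i + k"] by simp
        qed (use in_A in simp)
        then have "Until \<phi> \<psi> \<in> A j" if "j \<ge> i" for j
          using that by (auto simp: le_iff_add)
        then show False
          using fair[OF cl, of i] none unfolding fulfilled_def by blast
      qed
      then have ex: "\<exists>k. \<psi> \<in> A (i + k)"
        by (auto simp: le_iff_add)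
      define k where "k = (LEAST k. \<psi> \<in> A (i + k))"
      have k: "\<psi> \<in> A (i + k)"
        unfolding k_def using ex by (rule LeastI_ex)
      have before_k: "\<psi> \<notin> A (i + l)" if "l < k" for l
        using not_less_Least[OF that[unfolded k_def]] .
      have all: "Until \<phi> \<psi> \<in> A (i + l)" if "l \<le> k" for l
        using that
      proof (induction l)
        case (Suc l)
        then show ?case
          using before_k[of l] unfold[of "i + l"] by simp
      qed (use in_A in simp)
      have "\<phi> \<in> A l" if "i \<le> l" "l < i + k" for l
        using all[of "l - i"] before_k[of "l - i"] unfold[of l] that by auto
      then have "\<forall>l. i \<le> l \<and> l < i + k \<longrightarrow> cltl_sat \<sigma> l \<phi>"
        using \<phi> by blast
      moreover have "cltl_sat \<sigma> (i + k) \<psi>"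
        using k \<psi> by blast
      ultimately show "cltl_sat \<sigma> i (Until \<phi> \<psi>)"
        by (auto intro: exI[of _ "i + k"])
    next
      assume "cltl_sat \<sigma> i (Until \<phi> \<psi>)"
      then obtain j where j: "i \<le> j" "cltl_sat \<sigma> j \<psi>" "\<And>l. i \<le> l \<Longrightarrow> l < j \<Longrightarrow> cltl_sat \<sigma> l \<phi>"
        by auto
      define k where "k = j - i"
      have k: "\<psi> \<in> A (i + k)" "\<And>l. i \<le> l \<Longrightarrow> l < i + k \<Longrightarrow> \<phi> \<in> A l"
        using j \<phi> \<psi> by (simp_all add: k_def)
      \<comment> \<open>The induction runs backwards from the position \<open>i + k\<close>, where
        the promise is redeemed.\<close>
      have "Until \<phi> \<psi> \<in> A (i + (k - l))" if "l \<le> k" for l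
        using that
      proof (induction l)
        case 0
        then show ?case
          using k(1) unfold[of "i + k"] by simp
      next
        case (Suc l)
        then show ?case
          using k(2)[of "i + (k - Suc l)"] unfold[of "i + (k - Suc l)"] by (simp add: Suc_diff_Suc)
      qed
      from this[of k] show "Until \<phi> \<psi> \<in> A i"
        by simp
    qed
  next
    case (Constr c)
    then show ?case
      using step[of "Constr c" i] by simp
  next
    case (Neg \<phi>)
    then show ?case
      using step[of "Neg \<phi>" i] by simp
  next
    case (Disj \<phi> \<psi>)
    then show ?case
      using step[of "Disj \<phi> \<psi>" i] by simp
  next
    case (Next \<phi>)
    then show ?case
      using step[of "Next \<phi>" i] by simp
  qed
qed

text \<open>Together with \<open>fulfilled_of_truth\<close> this is the converse of
  \<open>tableau_truth\<close>: the truth sets of a model form a fair tableau run.\<close>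

lemma tableau_of_truth:
  assumes "sub \<Psi> = cl"
  shows "tableau cl (constr_sat \<sigma> i) {\<chi>\<in>cl. cltl_sat \<sigma> i \<chi>} {\<chi>\<in>cl. cltl_sat \<sigma> (Suc i) \<chi>}"
  unfolding tableau_def
proof
  fix \<chi>
  assume \<chi>: "\<chi> \<in> cl"
  then have "sub \<chi> \<subseteq> cl"
    using sub_trans assms by blast
  moreover have in_cl: "\<xi> \<in> cl" if "sub \<xi> \<subseteq> cl" for \<xi>
    using sub_self that by blast
  ultimately show "\<chi> \<in> {\<chi>\<in>cl. cltl_sat \<sigma> i \<chi>} \<longleftrightarrow>
      expand (constr_sat \<sigma> i) {\<chi>\<in>cl. cltl_sat \<sigma> i \<chi>} {\<chi>\<in>cl. cltl_sat \<sigma> (Suc i) \<chi>} \<chi>"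
    using \<chi> Until_unfold[of \<sigma> i] by (cases \<chi>) (auto dest!: in_cl simp del: cltl_sat.simps(5))
qed

lemma fulfilled_of_truth:
  assumes "sub \<Psi> = cl" "\<chi> \<in> cl"
  shows "\<exists>j\<ge>i. fulfilled {\<chi>\<in>cl. cltl_sat \<sigma> j \<chi>} \<chi>"
proof (cases "\<exists>\<phi> \<psi>. \<chi> = Until \<phi> \<psi> \<and> cltl_sat \<sigma> i \<chi>")
  case True
  then obtain \<phi> \<psi> j where "\<chi> = Until \<phi> \<psi>" "j \<ge> i" "cltl_sat \<sigma> j \<psi>"
    by auto
  moreover have "sub \<chi> \<subseteq> cl"
    using sub_trans assms by blast
  ultimately show ?thesis
    using sub_self by (auto simp: fulfilled_def simp del: cltl_sat.simps(5) intro!: exI[of _ j])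
next
  case False
  then show ?thesis
    by (auto simp: fulfilled_def simp del: cltl_sat.simps(5))
qed

section \<open>Fairness for all formulas as one recurring event\<close>

definition remaining :: "'v cltl set \<Rightarrow> 'v cltl set \<Rightarrow> 'v cltl set" where
  "remaining A P = {\<chi>\<in>P. \<not> fulfilled A \<chi>}"

text \<open>Degeneralisation: the pending set holds the formulas not yet fulfilled since the last
  reset, and fairness means that resets recur.\<close>

definition next_pending :: "'v cltl set \<Rightarrow> 'v cltl set \<Rightarrow> 'v cltl set \<Rightarrow> 'v cltl set" where
  "next_pending cl A P = (if remaining A P = {} then cl else remaining A P)"

text \<open>A formula that is never fulfilled again enters the pending set at the next reset, stays
  there, and blocks the reset after that.\<close>

lemma pending_fair:
  assumes P: "\<And>i. P (Suc i) = next_pending cl (A i) (P i)"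
    and inf: "\<And>i. \<exists>j\<ge>i. remaining (A j) (P j) = {}"
    and "\<chi> \<in> cl"
  shows "\<exists>j\<ge>i. fulfilled (A j) \<chi>"
proof (rule ccontr)
  assume none: "\<not> (\<exists>j\<ge>i. fulfilled (A j) \<chi>)"
  obtain j where j: "j \<ge> i" "remaining (A j) (P j) = {}"
    using inf by blast
  have "\<chi> \<in> P (Suc j + k)" for k
  proof (induction k)
    case 0
    then show ?case
      using j P[of j] assms(3) by (simp add: next_pending_def)
  next
    case (Suc k)
    then have "\<chi> \<in> remaining (A (Suc j + k)) (P (Suc j + k))"
      using none j(1) by (auto simp: remaining_def)
    then show ?case
      using P[of "Suc j + k"] by (auto simp: next_pending_def)
  qed
  moreover obtain k where k: "k \<ge> Suc j" "remaining (A k) (P k) = {}"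
    using inf by blast
  ultimately have "\<chi> \<in> P k"
    by (metis le_add_diff_inverse)
  moreover have "\<not> fulfilled (A k) \<chi>"
    using none j(1) k(1) by simp
  ultimately show False
    using k(2) by (auto simp: remaining_def)
qed

text \<open>Without a reset the pending set only shrinks, and each of its finitely many formulas
  leaves when it is fulfilled. Once all have left, a reset has to take place.\<close>

lemma fair_pending:
  assumes P: "\<And>i. P (Suc i) = next_pending cl (A i) (P i)"
    and fair: "\<And>\<chi> i. \<chi> \<in> cl \<Longrightarrow> \<exists>j\<ge>i. fulfilled (A j) \<chi>"
    and "P i \<subseteq> cl" and "finite cl"
  shows "\<exists>j\<ge>i. remaining (A j) (P j) = {}"
proof (rule ccontr)
  assume none: "\<not> (\<exists>j\<ge>i. remaining (A j) (P j) = {})"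
  have P_Suc: "P (Suc j) = remaining (A j) (P j)" if "i \<le> j" for j
    using P[of j] none that by (auto simp: next_pending_def)
  have decr: "P (j + k) \<subseteq> P j" if "i \<le> j" for j k
  proof (induction k)
    case (Suc k)
    have "P (Suc (j + k)) \<subseteq> P (j + k)"
      using P_Suc[of "j + k"] that by (auto simp: remaining_def)
    then show ?case
      using Suc by auto
  qed simp
  have "\<forall>\<chi>\<in>P i. \<exists>j. j \<ge> i \<and> fulfilled (A j) \<chi>"
    using fair[of _ i] assms(3) by auto
  then obtain g where g: "\<And>\<chi>. \<chi> \<in> P i \<Longrightarrow> g \<chi> \<ge> i \<and> fulfilled (A (g \<chi>)) \<chi>"
    using bchoice[of "P i" "\<lambda>\<chi> j. j \<ge> i \<and> fulfilled (A j) \<chi>"] by blast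
  \<comment> \<open>Each formula of \<open>P i\<close> has been fulfilled at least once between
    \<open>i\<close> and \<open>K\<close>.\<close>
  define K where "K = Max (insert i (g ` P i))"
  have fin: "finite (insert i (g ` P i))"
    using assms(3,4) finite_subset by blast
  have "i \<le> K"
    unfolding K_def using fin by simp
  have "\<chi> \<notin> P (Suc K)" if "\<chi> \<in> P i" for \<chi>
  proof -
    have "g \<chi> \<le> K"
      unfolding K_def using fin that by simp
    then have "P (Suc K) \<subseteq> P (Suc (g \<chi>))"
      using decr[of "Suc (g \<chi>)" "K - g \<chi>"] g[OF that] by simp
    moreover have "\<chi> \<notin> P (Suc (g \<chi>))"
      using P_Suc[of "g \<chi>"] g[OF that] by (simp add: remaining_def)
    ultimately show ?thesis
      by blast
  qed
  moreover have "P (Suc K) \<subseteq> P i"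
    using decr[of i "Suc K - i"] \<open>i \<le> K\<close> by (simp add: Suc_diff_le)
  ultimately have "P (Suc K) = {}"
    by blast
  then show False
    using none P_Suc[OF \<open>i \<le> K\<close>] \<open>i \<le> K\<close> by auto
qed


section \<open>Relativization\<close>

lemma constr_sat_cong:
  assumes "constr_over Va Vb c" "\<And>i x. x \<in> Va \<union> Vb \<Longrightarrow> \<sigma> i x = \<sigma>' i x"
  shows "constr_sat \<sigma> i c \<longleftrightarrow> constr_sat \<sigma>' i c"
  using assms by (cases c) auto

lemma prompt_sat_cong:
  assumes "prompt_over Va Vb \<phi>" "\<And>i x. x \<in> Va \<union> Vb \<Longrightarrow> \<sigma> i x = \<sigma>' i x"
  shows "prompt_sat \<sigma> i k \<phi> \<longleftrightarrow> prompt_sat \<sigma>' i k \<phi>"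
  using assms(1)
proof (induction \<phi> arbitrary: i)
  case (PConstr c)
  then show ?case
    using constr_sat_cong[OF _ assms(2)] by simp
qed simp_all

section \<open>Truth of the derived operators\<close>

lemma cltl_sat_Conj [simp]: "cltl_sat \<sigma> i (Conj \<phi> \<psi>) \<longleftrightarrow> cltl_sat \<sigma> i \<phi> \<and> cltl_sat \<sigma> i \<psi>"
  by (simp add: Conj_def)

lemma cltl_sat_Imp [simp]: "cltl_sat \<sigma> i (Imp \<phi> \<psi>) \<longleftrightarrow> (cltl_sat \<sigma> i \<phi> \<longrightarrow> cltl_sat \<sigma> i \<psi>)"
  by (simp add: Imp_def)

lemma cltl_sat_Finally [simp]: "cltl_sat \<sigma> i (Finally \<phi>) \<longleftrightarrow> (\<exists>j\<ge>i. cltl_sat \<sigma> j \<phi>)"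
  by (simp add: Finally_def)

lemma cltl_sat_Globally [simp]: "cltl_sat \<sigma> i (Globally \<phi>) \<longleftrightarrow> (\<forall>j\<ge>i. cltl_sat \<sigma> j \<phi>)"
  by (simp add: Globally_def)

lemma cltl_sat_colour [simp]: "cltl_sat \<sigma> i (colour xc yc) \<longleftrightarrow> \<sigma> i xc = \<sigma> i yc"
  by (simp add: colour_def)

lemma cltl_sat_colour_cltl:
  "cltl_sat \<sigma> 0 (colour_cltl xc yc \<phi>) \<longleftrightarrow>
     (\<forall>i. \<exists>j\<ge>i. \<sigma> j xc = \<sigma> j yc) \<and> (\<forall>i. \<exists>j\<ge>i. \<sigma> j xc \<noteq> \<sigma> j yc) \<and>
     cltl_sat \<sigma> 0 (relativize (colour xc yc) \<phi>)"
  by (simp add: colour_cltl_def)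

text \<open>A stretch of one colour has length at most \<open>N\<close>, and the translation reaches
  its target within two stretches. Below an odd number of negations the implication is needed in the
  other direction, which \<open>b\<close> records.\<close>

lemma relativize_imp_prompt:
  assumes bound: "\<And>i c. \<exists>j\<ge>i. j \<le> i + N \<and> (\<sigma> j xc = \<sigma> j yc \<longleftrightarrow> c)"
    and "prompt_polarity b \<phi>"
  shows "if b then cltl_sat \<sigma> i (relativize (colour xc yc) \<phi>) \<longrightarrow> prompt_sat \<sigma> i (2 * N) \<phi>
         else prompt_sat \<sigma> i (2 * N) \<phi> \<longrightarrow> cltl_sat \<sigma> i (relativize (colour xc yc) \<phi>)"
  using assms(2)
proof (induction \<phi> arbitrary: b i)
  case (PNeg \<phi>)
  show ?case
    using PNeg.IH[of "\<not> b" i] PNeg.prems by (cases b) auto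
next
  case (PDisj \<phi> \<psi>)
  then show ?case
    using PDisj.IH(1)[of b i] PDisj.IH(2)[of b i] by (cases b) (simp; blast)+
next
  case (PNext \<phi>)
  then show ?case
    using PNext.IH[of b "Suc i"] by (cases b) simp_all
next
  case (PUntil \<phi> \<psi>)
  have "b \<Longrightarrow> cltl_sat \<sigma> l (relativize (colour xc yc) \<phi>) \<Longrightarrow> prompt_sat \<sigma> l (2 * N) \<phi>"
    "b \<Longrightarrow> cltl_sat \<sigma> l (relativize (colour xc yc) \<psi>) \<Longrightarrow> prompt_sat \<sigma> l (2 * N) \<psi>"
    "\<not> b \<Longrightarrow> prompt_sat \<sigma> l (2 * N) \<phi> \<Longrightarrow> cltl_sat \<sigma> l (relativize (colour xc yc) \<phi>)"
    "\<not> b \<Longrightarrow> prompt_sat \<sigma> l (2 * N) \<psi> \<Longrightarrow> cltl_sat \<sigma> l (relativize (colour xc yc) \<psi>)" for l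
    using PUntil.IH(1)[of b l] PUntil.IH(2)[of b l] PUntil.prems by simp_all
  then show ?case
    by (cases b) (simp; blast)+
next
  case (FPrompt \<phi>)
  have b: "b"
    using FPrompt.prems by simp
  have IH: "cltl_sat \<sigma> l (relativize (colour xc yc) \<phi>) \<Longrightarrow> prompt_sat \<sigma> l (2 * N) \<phi>" for l
    using FPrompt.IH[of True l] FPrompt.prems by (cases b) simp_all
  have "prompt_sat \<sigma> i (2 * N) (FPrompt \<phi>)"
    if sat: "cltl_sat \<sigma> i (relativize (colour xc yc) (FPrompt \<phi>))"
  proof -
    define c where "c \<longleftrightarrow> \<sigma> i xc = \<sigma> i yc"
    \<comment> \<open>Whichever colour \<open>c\<close> holds at \<open>i\<close>, one conjunct of
      the translation applies: a stretch of \<open>c\<close> up to \<open>j\<close>, then one of the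
      other colour up to \<open>j'\<close>.\<close>
    have "\<exists>j\<ge>i. (\<exists>j'\<ge>j. cltl_sat \<sigma> j' (relativize (colour xc yc) \<phi>) \<and>
        (\<forall>l. j \<le> l \<and> l < j' \<longrightarrow> (\<sigma> l xc = \<sigma> l yc) = (\<not> c))) \<and>
        (\<forall>l. i \<le> l \<and> l < j \<longrightarrow> (\<sigma> l xc = \<sigma> l yc) = c)"
      using sat unfolding c_def by (cases "\<sigma> i xc = \<sigma> i yc") simp_all
    then obtain j j' where j: "i \<le> j" "j \<le> j'" "cltl_sat \<sigma> j' (relativize (colour xc yc) \<phi>)"
        and c1: "\<And>l. j \<le> l \<Longrightarrow> l < j' \<Longrightarrow> (\<sigma> l xc = \<sigma> l yc) = (\<not> c)"
        and c2: "\<And>l. i \<le> l \<Longrightarrow> l < j \<Longrightarrow> (\<sigma> l xc = \<sigma> l yc) = c"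
      by blast
    have "j \<le> i + N"
      using bound[of i "\<not> c"] c2 by (meson le_trans not_le)
    moreover have "j' \<le> j + N"
      using bound[of j c] c1 by (meson le_trans not_le)
    ultimately show ?thesis
      using j IH[of j'] by (auto intro!: exI[of _ j'])
  qed
  then show ?case
    using b by simp
qed simp

text \<open>With colour blocks of length \<open>k + 1\<close>, the positions from \<open>i\<close>
  to \<open>i + k\<close> contain at most one colour change, as the translation permits.\<close>

lemma prompt_imp_relativize:
  assumes colours: "\<And>j. \<sigma> j xc = \<sigma> j yc \<longleftrightarrow> even (j div Suc k)"
    and "prompt_polarity b \<phi>"
  shows "if b then prompt_sat \<sigma> i k \<phi> \<longrightarrow> cltl_sat \<sigma> i (relativize (colour xc yc) \<phi>)
         else cltl_sat \<sigma> i (relativize (colour xc yc) \<phi>) \<longrightarrow> prompt_sat \<sigma> i k \<phi>"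
  using assms(2)
proof (induction \<phi> arbitrary: b i)
  case (PNeg \<phi>)
  show ?case
    using PNeg.IH[of "\<not> b" i] PNeg.prems by (cases b) auto
next
  case (PDisj \<phi> \<psi>)
  then show ?case
    using PDisj.IH(1)[of b i] PDisj.IH(2)[of b i] by (cases b) (simp; blast)+
next
  case (PNext \<phi>)
  then show ?case
    using PNext.IH[of b "Suc i"] by (cases b) simp_all
next
  case (PUntil \<phi> \<psi>)
  have "b \<Longrightarrow> prompt_sat \<sigma> l k \<phi> \<Longrightarrow> cltl_sat \<sigma> l (relativize (colour xc yc) \<phi>)"
    "b \<Longrightarrow> prompt_sat \<sigma> l k \<psi> \<Longrightarrow> cltl_sat \<sigma> l (relativize (colour xc yc) \<psi>)"
    "\<not> b \<Longrightarrow> cltl_sat \<sigma> l (relativize (colour xc yc) \<phi>) \<Longrightarrow> prompt_sat \<sigma> l k \<phi>"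
    "\<not> b \<Longrightarrow> cltl_sat \<sigma> l (relativize (colour xc yc) \<psi>) \<Longrightarrow> prompt_sat \<sigma> l k \<psi>" for l
    using PUntil.IH(1)[of b l] PUntil.IH(2)[of b l] PUntil.prems by simp_all
  then show ?case
    by (cases b) (simp; blast)+
next
  case (FPrompt \<phi>)
  have b: "b"
    using FPrompt.prems by simp
  have IH: "prompt_sat \<sigma> l k \<phi> \<Longrightarrow> cltl_sat \<sigma> l (relativize (colour xc yc) \<phi>)" for l
    using FPrompt.IH[of True l] FPrompt.prems by (cases b) simp_all
  have "cltl_sat \<sigma> i (relativize (colour xc yc) (FPrompt \<phi>))"
    if "prompt_sat \<sigma> i k (FPrompt \<phi>)"
  proof -
    obtain j where j: "i \<le> j" "j \<le> i + k" "cltl_sat \<sigma> j (relativize (colour xc yc) \<phi>)"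
      using \<open>prompt_sat \<sigma> i k (FPrompt \<phi>)\<close> IH by auto
    define q where "q = i div Suc k"
    \<comment> \<open>The point of the colour change: the start of the next block, or
      \<open>j\<close> itself if \<open>j\<close> comes before it.\<close>
    define m where "m = min j (Suc q * Suc k)"
    have i_le: "q * Suc k \<le> i"
      unfolding q_def by (rule div_times_less_eq_dividend)
    have i_less: "i < Suc q * Suc k"
      unfolding q_def using dividend_less_div_times[of "Suc k" i] by simp
    have block1: "l div Suc k = q" if "i \<le> l" "l < m" for l
    proof -
      have "q * Suc k \<le> l" "l < Suc q * Suc k"
        using that i_le unfolding m_def by auto
      then show ?thesis
        by (intro div_nat_eqI) (simp_all add: mult.commute)
    qed
    have block2: "l div Suc k = Suc q" if "m \<le> l" "l < j" for l
    proof -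
      have "Suc q * Suc k \<le> l" "l < Suc (Suc q) * Suc k"
        using that i_less j unfolding m_def by auto
      then show ?thesis
        by (intro div_nat_eqI) (simp_all add: mult.commute)
    qed
    have c1: "(\<sigma> l xc = \<sigma> l yc) = (\<sigma> i xc = \<sigma> i yc)" if "i \<le> l" "l < m" for l
      using block1[OF that] by (simp add: colours q_def)
    have c2: "(\<sigma> l xc = \<sigma> l yc) = (\<sigma> i xc \<noteq> \<sigma> i yc)" if "m \<le> l" "l < j" for l
      using block2[OF that] by (simp add: colours q_def)
    have m: "i \<le> m" "m \<le> j"
      unfolding m_def using j i_less by auto
    show ?thesis
      using m j c1 c2 by (cases "\<sigma> i xc = \<sigma> i yc") (simp; blast)+
  qed
  then show ?case
    using b by simp
qed simp

section \<open>From the prompt game to the coloured game\<close>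

lemma system_wins_prompt_imp_cltl:
  assumes EV: "EV \<subseteq> V" and V: "xc \<notin> V" "yc \<notin> V" "xc \<noteq> yc"
    and over: "prompt_over Va Vb \<phi>" "Va \<union> Vb = V" and pos: "prompt_positive \<phi>"
    and wins: "system_wins_prompt EV V \<phi>"
  shows "system_wins_cltl EV (V \<union> {xc, yc}) (colour_cltl xc yc \<phi>)"
proof -
  obtain \<tau> k where \<tau>: "is_strategy EV V \<tau>"
      and sat: "\<And>\<sigma>. consistent EV V \<tau> \<sigma> \<Longrightarrow> prompt_sat \<sigma> 0 k \<phi>"
    using wins unfolding system_wins_prompt_def by blast
  \<comment> \<open>\<open>length h\<close> is the number of the current round. The colour variables
    are equal exactly in the even blocks, and \<open>\<tau>\<close> sees the history without
    them.\<close>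
  define \<tau>' where "\<tau>' h e = (\<lambda>x\<in>V \<union> {xc, yc} - EV.
      if x = xc then 0 else if x = yc then (if even (length h div Suc k) then 0 else 1)
      else \<tau> (map (\<lambda>v. restrict v V) h) e x)" for h e
  have "is_strategy EV (V \<union> {xc, yc}) \<tau>'"
    unfolding is_strategy_def \<tau>'_def by auto
  moreover have "cltl_sat \<sigma> 0 (colour_cltl xc yc \<phi>)"
    if cons: "consistent EV (V \<union> {xc, yc}) \<tau>' \<sigma>" for \<sigma>
  proof -
    have val: "\<sigma> i x = \<tau>' (map \<sigma> [0..<i]) (restrict (\<sigma> i) EV) x" if "x \<in> V \<union> {xc, yc} - EV" for i x
      using cons that unfolding consistent_def by (metis restrict_apply')
    have "consistent EV V \<tau> (\<lambda>i. restrict (\<sigma> i) V)"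
      unfolding consistent_def
    proof (intro conjI allI)
      fix i
      show "restrict (\<sigma> i) V \<in> V \<rightarrow>\<^sub>E UNIV"
        by auto
      let ?h = "map (\<lambda>i. restrict (\<sigma> i) V) [0..<i]"
      have e: "restrict (restrict (\<sigma> i) V) EV = restrict (\<sigma> i) EV"
        using EV by (auto simp: restrict_def fun_eq_iff)
      have "?h \<in> lists (V \<rightarrow>\<^sub>E UNIV)" "restrict (\<sigma> i) EV \<in> EV \<rightarrow>\<^sub>E UNIV"
        by auto
      then have ext: "\<tau> ?h (restrict (\<sigma> i) EV) \<in> (V - EV) \<rightarrow>\<^sub>E UNIV"
        using \<tau> unfolding is_strategy_def by blast
      show "restrict (restrict (\<sigma> i) V) (V - EV) = \<tau> ?h (restrict (restrict (\<sigma> i) V) EV)"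
        unfolding e
      proof
        fix x
        show "restrict (restrict (\<sigma> i) V) (V - EV) x = \<tau> ?h (restrict (\<sigma> i) EV) x"
        proof (cases "x \<in> V - EV")
          case True
          then show ?thesis
            using val[of x i] V by (auto simp: \<tau>'_def comp_def)
        next
          case False
          then show ?thesis
            using ext by (auto simp: PiE_def extensional_def)
        qed
      qed
    qed
    then have "prompt_sat (\<lambda>i. restrict (\<sigma> i) V) 0 k \<phi>"
      by (rule sat)
    then have psat: "prompt_sat \<sigma> 0 k \<phi>"
      by (subst prompt_sat_cong[OF over(1), of \<sigma> "\<lambda>i. restrict (\<sigma> i) V"]) (simp_all add: over(2))
    have colours: "\<sigma> j xc = \<sigma> j yc \<longleftrightarrow> even (j div Suc k)" for j
    proof -
      have "xc \<notin> EV" "yc \<notin> EV"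
        using EV V by auto
      then show ?thesis
        using val[of xc j] val[of yc j] V by (auto simp: \<tau>'_def)
    qed
    \<comment> \<open>Positions \<open>2 * i * Suc k\<close> and \<open>Suc (2 * i) * Suc k\<close>
      start an even and an odd block, so both colours recur.\<close>
    have div: "n * Suc k div Suc k = n" "n \<le> n * Suc k" for n
      by (rule nonzero_mult_div_cancel_right) simp_all
    have "\<exists>j\<ge>i. even (j div Suc k)" for i
      using div[of "2 * i"] by (intro exI[of _ "2 * i * Suc k"]) (auto simp del: mult_Suc_right)
    moreover have "\<exists>j\<ge>i. odd (j div Suc k)" for i
      using div[of "Suc (2 * i)"] by (intro exI[of _ "Suc (2 * i) * Suc k"]) (auto simp del: mult_Suc_right)
    ultimately show ?thesis
      using prompt_imp_relativize[of \<sigma> xc yc k True \<phi> 0, OF colours pos] psat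
      unfolding cltl_sat_colour_cltl colours by simp
  qed
  ultimately show ?thesis
    unfolding system_wins_cltl_def by blast
qed


section \<open>Cutting and pasting a winning strategy\<close>

primrec width :: "'v constr \<Rightarrow> nat" where
  "width (LookAhead r a x b y) = Suc (max a b)"
| "width (FutureBlind r x y) = 1"

text \<open>\<open>Va\<close> already contains the two colour variables. The recurrence of both
  colours is kept apart from \<open>\<psi>\<close> as \<open>colours\<close>, and \<open>W\<close>
  bounds how far a constraint of \<open>\<psi>\<close> looks.\<close>

locale winning_strategy =
  fixes Va Vb EV :: "'v set" and xc yc :: 'v and \<tau> :: "'v strategy" and \<psi> :: "'v cltl" and W :: nat
  assumes finite_Va: "finite Va" and finite_Vb: "finite Vb" and disjoint: "Va \<inter> Vb = {}"
    and EV_sub: "EV \<subseteq> Vb" and xc: "xc \<in> Va" and yc: "yc \<in> Va"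
    and strat: "is_strategy EV (Va \<union> Vb) \<tau>"
    and wins: "consistent EV (Va \<union> Vb) \<tau> \<sigma> \<Longrightarrow> cltl_sat \<sigma> 0 \<psi>"
    and colours: "consistent EV (Va \<union> Vb) \<tau> \<sigma> \<Longrightarrow> \<exists>j\<ge>i. (\<sigma> j xc = \<sigma> j yc) = b"
    and W_pos: "0 < W"
    and constrs: "Constr c \<in> sub \<psi> \<Longrightarrow> constr_over Va Vb c \<and> width c \<le> W"
begin

abbreviation V :: "'v set" where
  "V \<equiv> Va \<union> Vb"

section \<open>Histories of the given strategy\<close>

definition hist :: "'v valuation list \<Rightarrow> bool" where
  "hist h \<longleftrightarrow> (\<forall>i<length h. h ! i \<in> V \<rightarrow>\<^sub>E UNIV \<and>
     restrict (h ! i) (V - EV) = \<tau> (take i h) (restrict (h ! i) EV))"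

lemma hist_Nil: "hist []"
  by (simp add: hist_def)

lemma hist_snoc:
  "hist (h @ [v]) \<longleftrightarrow> hist h \<and> v \<in> V \<rightarrow>\<^sub>E UNIV \<and> restrict v (V - EV) = \<tau> h (restrict v EV)"
proof -
  have "(h @ [v]) ! i = h ! i" "take i (h @ [v]) = take i h" if "i < length h" for i
    using that by (simp_all add: nth_append)
  then show ?thesis
    unfolding hist_def by (auto simp: All_less_Suc)
qed

lemma hist_lists: "hist h \<Longrightarrow> h \<in> lists (V \<rightarrow>\<^sub>E UNIV)"
  unfolding hist_def lists_eq_set by (metis (no_types, lifting) in_set_conv_nth mem_Collect_eq subsetI)

text \<open>The union of growing histories is a consistent play. The chain may start at any history,
  because one-colour runs may start anywhere.\<close>

lemma hist_chain:
  assumes snoc: "\<And>i. \<exists>v. hs (Suc i) = hs i @ [v]" and hist: "\<And>i. hist (hs i)"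
  obtains \<sigma> where "consistent EV V \<tau> \<sigma>" "\<And>i. hs i = map \<sigma> [0..<length (hs 0) + i]"
proof -
  have len: "length (hs i) = length (hs 0) + i" for i
  proof (induction i)
    case (Suc i)
    then show ?case
      using snoc[of i] by auto
  qed simp
  have pre: "hs (i + k) ! j = hs i ! j" if "j < length (hs i)" for i j k
  proof (induction k)
    case (Suc k)
    obtain v where "hs (Suc (i + k)) = hs (i + k) @ [v]"
      using snoc by blast
    moreover have "j < length (hs (i + k))"
      using that len[of i] len[of "i + k"] by simp
    ultimately show ?case
      using Suc by (simp add: nth_append)
  qed simp
  \<comment> \<open>\<open>hs (Suc j)\<close> has length at least \<open>Suc j\<close>, so position
    \<open>j\<close> exists in it.\<close>
  define \<sigma> where "\<sigma> j = hs (Suc j) ! j" for j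
  have hs: "hs i = map \<sigma> [0..<length (hs 0) + i]" for i
  proof (rule nth_equalityI)
    fix j
    assume j: "j < length (hs i)"
    have j': "j < length (hs (Suc j))"
      using len[of "Suc j"] by simp
    have "hs i ! j = hs (Suc j) ! j"
    proof (cases "i \<le> Suc j")
      case True
      then show ?thesis
        using pre[OF j, of "Suc j - i"] by simp
    next
      case False
      then show ?thesis
        using pre[OF j', of "i - Suc j"] by simp
    qed
    then show "hs i ! j = map \<sigma> [0..<length (hs 0) + i] ! j"
      using j len[of i] by (simp add: \<sigma>_def)
  qed (simp add: len[of i])
  have "consistent EV V \<tau> \<sigma>"
    unfolding consistent_def
  proof (intro conjI allI)
    fix i
    have i: "i < length (hs (Suc i))"
      using len[of "Suc i"] by simp
    have *: "hs (Suc i) ! i = \<sigma> i"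
      by (simp add: \<sigma>_def)
    have "take i (hs (Suc i)) = map \<sigma> [0..<i]"
      unfolding hs[of "Suc i"] by (simp add: take_map)
    then show "\<sigma> i \<in> V \<rightarrow>\<^sub>E UNIV"
        "restrict (\<sigma> i) (V - EV) = \<tau> (map \<sigma> [0..<i]) (restrict (\<sigma> i) EV)"
      using hist[of "Suc i", unfolded hist_def, rule_format, OF i] unfolding * by simp_all
  qed
  then show ?thesis
    using that hs by blast
qed

text \<open>
  The last \<open>W\<close> valuations of a history, as a model whose position 0 is the oldest of them.
  Valuations before the beginning of the play are taken to be 0.
\<close>

definition win :: "'v valuation list \<Rightarrow> 'v model" where
  "win h a = (replicate W (\<lambda>_. 0) @ h) ! (length h + a)"

lemma win_snoc: "a < W \<Longrightarrow> win (h @ [v]) a = (if Suc a < W then win h (Suc a) else v)"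
proof -
  assume "a < W"
  have "(replicate W (\<lambda>_. 0) @ h @ [v]) ! (Suc (length h) + a) =
      (if Suc a < W then (replicate W (\<lambda>_. 0) @ h) ! (length h + Suc a) else v)"
    using \<open>a < W\<close> nth_append[of "replicate W (\<lambda>_. 0) @ h" "[v]" "Suc (length h) + a"] by auto
  then show ?thesis
    by (simp add: win_def)
qed

lemma win_map: "a < W \<Longrightarrow> win (map \<sigma> [0..<n]) a = pad W \<sigma> (n + a)"
  by (simp add: win_def nth_append pad_def)

text \<open>Constraints see only comparisons: of look-ahead variables across the whole window, and
  of future-blind variables at its oldest position. This is what permits relabelling the former and
  never comparing the latter across positions.\<close>

lemma constr_sat_window:
  assumes "Constr c \<in> sub \<psi>"
    and "\<And>r a b x y. a < W \<Longrightarrow> b < W \<Longrightarrow> x \<in> Va \<Longrightarrow> y \<in> Va \<Longrightarrow>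
      rel_sat r (\<sigma> (i + a) x) (\<sigma> (i + b) y) \<longleftrightarrow> rel_sat r (w a x) (w b y)"
    and "\<And>r x y. x \<in> Vb \<Longrightarrow> y \<in> Vb \<Longrightarrow> rel_sat r (\<sigma> i x) (\<sigma> i y) \<longleftrightarrow> rel_sat r (w 0 x) (w 0 y)"
  shows "constr_sat \<sigma> i c \<longleftrightarrow> constr_sat w 0 c"
  using constrs[OF assms(1)] assms(2,3) by (cases c) auto

section \<open>Refuting runs and one-colour runs\<close>

definition \<Psi> :: "'v cltl" where
  "\<Psi> = (Next ^^ W) \<psi>"

definition cl :: "'v cltl set" where
  "cl = sub \<Psi>"

lemma finite_cl: "finite cl"
  by (simp add: cl_def finite_sub)

lemma Constr_in_cl: "Constr c \<in> cl \<longleftrightarrow> Constr c \<in> sub \<psi>"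
  by (simp add: cl_def \<Psi>_def Constr_in_sub_Next)

lemma tableau_cong:
  assumes "\<And>c. Constr c \<in> cl \<Longrightarrow> L c = L' c"
  shows "tableau cl L A A' \<longleftrightarrow> tableau cl L' A A'"
proof -
  have "expand L A A' \<chi> = expand L' A A' \<chi>" if "\<chi> \<in> cl" for \<chi>
    using assms that by (cases \<chi>) auto
  then show ?thesis
    by (simp add: tableau_def)
qed

text \<open>A run from the empty history is a play with a tableau for its padded version:
  \<open>A\<close> labels padded position \<open>length h\<close>, whose constraints the window of
  \<open>h\<close> decides. The resets of the pending set are the steps in
  \<open>tbad\<close>.\<close>

definition tstep :: "'v valuation list \<times> 'v cltl set \<times> 'v cltl set \<Rightarrow>
    'v valuation list \<times> 'v cltl set \<times> 'v cltl set \<Rightarrow> bool" where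
  "tstep = (\<lambda>(h, A, P) (h', A', P'). (\<exists>v. h' = h @ [v]) \<and> hist h' \<and>
     tableau cl (constr_sat (win h) 0) A A' \<and> P' = next_pending cl A P)"

definition tbad :: "'v valuation list \<times> 'v cltl set \<times> 'v cltl set \<Rightarrow>
    'v valuation list \<times> 'v cltl set \<times> 'v cltl set \<Rightarrow> bool" where
  "tbad = (\<lambda>(h, A, P) s. tstep (h, A, P) s \<and> remaining A P = {})"

text \<open>Taken both as steps and as bad steps, so that the resulting rank drops in every round
  that keeps the colour \<open>c\<close>.\<close>

definition cstep :: "'v valuation list \<times> bool \<Rightarrow> 'v valuation list \<times> bool \<Rightarrow> bool" where
  "cstep = (\<lambda>(h, c) (h', c'). c' = c \<and> (\<exists>v. h' = h @ [v] \<and> (v xc = v yc) = c) \<and> hist h \<and> hist h')"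

text \<open>The limit is a consistent play with a fair tableau, so \<open>A\<close> is exact about
  \<open>\<Psi>\<close>, which is true since the strategy wins. Initial states whose guess lacks
  \<open>\<Psi>\<close> therefore allow only finitely many resets.\<close>

lemma no_fair_refuting_run:
  assumes f: "f 0 = ([], A, P)" "\<And>i. tstep (f i) (f (Suc i))" "\<And>i. \<exists>j\<ge>i. tbad (f j) (f (Suc j))"
  shows "\<Psi> \<in> A"
proof -
  define hs where "hs i = fst (f i)" for i
  define As where "As i = fst (snd (f i))" for i
  define Ps where "Ps i = snd (snd (f i))" for i
  have f_eq: "f i = (hs i, As i, Ps i)" for i
    by (simp add: hs_def As_def Ps_def)
  have hs0: "hs 0 = []" and As0: "As 0 = A"
    by (simp_all add: hs_def As_def f(1))
  have step: "(\<exists>v. hs (Suc i) = hs i @ [v]) \<and> hist (hs (Suc i)) \<and>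
      tableau cl (constr_sat (win (hs i)) 0) (As i) (As (Suc i)) \<and>
      Ps (Suc i) = next_pending cl (As i) (Ps i)" for i
    using f(2)[of i] unfolding f_eq tstep_def by simp
  have hist: "hist (hs i)" for i
  proof (cases i)
    case 0
    then show ?thesis
      using hs0 hist_Nil by simp
  next
    case (Suc k)
    then show ?thesis
      using step[of k] by simp
  qed
  have snoc: "\<exists>v. hs (Suc i) = hs i @ [v]" for i
    using step[of i] by blast
  obtain \<sigma> where \<sigma>: "consistent EV V \<tau> \<sigma>" "\<And>i. hs i = map \<sigma> [0..<i]"
    using hist_chain[of hs, OF snoc hist] hs0 by auto
  have tab: "tableau cl (constr_sat (pad W \<sigma>) i) (As i) (As (Suc i))" for i
  proof -
    have "constr_sat (pad W \<sigma>) i c = constr_sat (win (hs i)) 0 c" if "Constr c \<in> cl" for c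
    proof (rule constr_sat_window)
      show "Constr c \<in> sub \<psi>"
        using that by (simp add: Constr_in_cl)
    qed (use W_pos in \<open>simp_all add: \<sigma>(2) win_map\<close>)
    then show ?thesis
      using step[of i] tableau_cong[of "constr_sat (pad W \<sigma>) i" "constr_sat (win (hs i)) 0"] by blast
  qed
  have inf: "\<exists>j\<ge>i. remaining (As j) (Ps j) = {}" for i
    using f(3)[of i] unfolding f_eq tbad_def by auto
  have "\<exists>j\<ge>i. fulfilled (As j) \<chi>" if "\<chi> \<in> cl" for i \<chi>
    by (rule pending_fair[of Ps cl As, OF _ inf that]) (use step in blast)
  then have "\<Psi> \<in> As 0 \<longleftrightarrow> cltl_sat (pad W \<sigma>) 0 \<Psi>"
    by (intro tableau_truth[of cl]) (use tab in \<open>simp_all add: cl_def\<close>)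
  moreover have "cltl_sat (pad W \<sigma>) 0 \<Psi>"
    unfolding \<Psi>_def cltl_sat_pad using wins[OF \<sigma>(1)] .
  ultimately show ?thesis
    using As0 by simp
qed

text \<open>Its limit would be a consistent play with a single colour from some position on, against
  \<open>colours\<close>.\<close>

lemma no_monochromatic_run: "\<not> (\<forall>i. cstep (f i) (f (Suc i)))"
proof
  assume run: "\<forall>i. cstep (f i) (f (Suc i))"
  define hs where "hs i = fst (f i)" for i
  define c where "c = snd (f 0)"
  have step: "(\<exists>v. hs (Suc i) = hs i @ [v] \<and> (v xc = v yc) = snd (f i)) \<and> hist (hs i) \<and>
      snd (f (Suc i)) = snd (f i)" for i
    using run[THEN spec, of i] unfolding cstep_def hs_def by (auto simp: case_prod_beta)
  have col: "snd (f i) = c" for i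
  proof (induction i)
    case (Suc i)
    then show ?case
      using step[of i] by simp
  qed (simp add: c_def)
  have snoc: "\<exists>v. hs (Suc i) = hs i @ [v]" for i
    using step[of i] by blast
  have hist: "hist (hs i)" for i
    using step[of i] by blast
  obtain \<sigma> where \<sigma>: "consistent EV V \<tau> \<sigma>" "\<And>i. hs i = map \<sigma> [0..<length (hs 0) + i]"
    using hist_chain[of hs, OF snoc hist] by blast
  obtain j where j: "j \<ge> length (hs 0)" "(\<sigma> j xc = \<sigma> j yc) = (\<not> c)"
    using colours[OF \<sigma>(1)] by blast
  obtain v where v: "hs (Suc (j - length (hs 0))) = hs (j - length (hs 0)) @ [v]" "(v xc = v yc) = c"
    using step[of "j - length (hs 0)"] col by blast
  have "v = \<sigma> j"
    using v(1) j(1) unfolding \<sigma>(2)[of "Suc (j - length (hs 0))"] \<sigma>(2)[of "j - length (hs 0)"] by simp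
  then show False
    using v(2) j(2) by simp
qed

end

text \<open>
  \<open>dominates m h\<close> allows the play to continue from \<open>m\<close> after it has reached \<open>h\<close>: both windows have
  the same order type, and the gaps and all ranks are at most those at \<open>h\<close>. This is a
  well-quasi-order, so finitely many histories \<open>M\<close> suffice.
\<close>

locale ranked_strategy = winning_strategy Va Vb EV xc yc \<tau> \<psi> W
  for Va Vb EV :: "'v set" and xc yc \<tau> \<psi> W +
  fixes rk1 :: "'v valuation list \<times> 'v cltl set \<times> 'v cltl set \<Rightarrow> 'r::wellorder" and F1
    and rk2 :: "'v valuation list \<times> bool \<Rightarrow> 's::wellorder"
  assumes rk1_step: "tstep s s' \<Longrightarrow> rk1 s' \<le> rk1 s"
    and rk1_bad: "tbad s s' \<Longrightarrow> s \<in> F1 \<Longrightarrow> rk1 s' < rk1 s"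
    and F1_down: "s \<in> F1 \<Longrightarrow> rk1 s' \<le> rk1 s \<Longrightarrow> s' \<in> F1"
    and F1_init: "\<Psi> \<notin> A \<Longrightarrow> ([], A, P) \<in> F1"
    and rk2_step: "cstep t t' \<Longrightarrow> rk2 t' < rk2 t"
begin

section \<open>Domination and its finite basis\<close>

definition dominates :: "'v valuation list \<Rightarrow> 'v valuation list \<Rightarrow> bool" where
  "dominates m h \<longleftrightarrow>
     (\<forall>a\<in>{..<W}. \<forall>b\<in>{..<W}. \<forall>x\<in>Va. \<forall>y\<in>Va.
        (win m a x \<le> win m b y) = (win h a x \<le> win h b y) \<and>
        nat (win m b y - win m a x) \<le> nat (win h b y - win h a x)) \<and>
     (\<forall>a\<in>{..<W}. \<forall>x\<in>Vb. \<forall>y\<in>Vb. (win m a x \<le> win m a y) = (win h a x \<le> win h a y)) \<and>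
     (\<forall>s\<in>Pow cl \<times> Pow cl. rk1 (m, s) \<le> rk1 (h, s)) \<and>
     (\<forall>c\<in>UNIV. rk2 (m, c) \<le> rk2 (h, c))"

text \<open>Finitely many equalities of truth values and inequalities in well-orders are combined;
  truncating gaps by \<open>nat\<close> puts them into a well-order.\<close>

lemma wqo_dominates: "wqo dominates"
proof -
  have "wqo (\<lambda>m h. (\<forall>a\<in>{..<W}. \<forall>b\<in>{..<W}. \<forall>x\<in>Va. \<forall>y\<in>Va.
        (win m a x \<le> win m b y) = (win h a x \<le> win h b y) \<and>
        nat (win m b y - win m a x) \<le> nat (win h b y - win h a x)) \<and>
     (\<forall>a\<in>{..<W}. \<forall>x\<in>Vb. \<forall>y\<in>Vb. (win m a x \<le> win m a y) = (win h a x \<le> win h a y)) \<and>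
     (\<forall>s\<in>Pow cl \<times> Pow cl. rk1 (m, s) \<le> rk1 (h, s)) \<and>
     (\<forall>c\<in>UNIV. rk2 (m, c) \<le> rk2 (h, c)))"
    by (intro wqo_conj wqo_Ball wqo_bool_eq wqo_le)
      (simp_all add: finite_Va finite_Vb finite_cl)
  then show ?thesis
    by (rule wqo_mono) (simp add: dominates_def)
qed

definition M :: "'v valuation list set" where
  "M = (SOME M. finite M \<and> M \<subseteq> Collect hist \<and> (\<forall>h\<in>Collect hist. \<exists>m\<in>M. dominates m h))"

lemma M: "finite M" "m \<in> M \<Longrightarrow> hist m" "hist h \<Longrightarrow> \<exists>m. m \<in> M \<and> dominates m h"
  using someI_ex[OF wqo_finite_basis[OF wqo_dominates, of "Collect hist"], folded M_def] by auto

text \<open>The points are pairs of a window position and a variable. The new map \<open>G\<close>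
  assigns to the window of \<open>m\<close> the values that \<open>F\<close> assigned to that of
  \<open>h\<close>, so values already played stay fixed.\<close>

lemma dominates_relabel:
  assumes "strict_mono F" "dominates m h"
  shows "\<exists>G :: int \<Rightarrow> int. strict_mono G \<and> (\<forall>a<W. \<forall>x\<in>Va. G (win m a x) = F (win h a x))"
proof -
  have *: "(win m a x \<le> win m b y) = (win h a x \<le> win h b y)"
    "nat (win m b y - win m a x) \<le> nat (win h b y - win h a x)"
    if "a < W" "b < W" "x \<in> Va" "y \<in> Va" for a b x y
    using assms(2) that unfolding dominates_def by simp_all
  have gap: "win m b y - win m a x \<le> win h b y - win h a x"
    if "a < W" "b < W" "x \<in> Va" "y \<in> Va" "win m a x \<le> win m b y" for a b x y
    using *[OF that(1-4)] that(5) by simp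
  have "\<exists>G :: int \<Rightarrow> int. strict_mono G \<and>
      (\<forall>p\<in>{..<W} \<times> Va. G (win m (fst p) (snd p)) = F (win h (fst p) (snd p)))"
  proof (rule strict_mono_relabel[OF assms(1)])
    show "finite ({..<W} \<times> Va)"
      using finite_Va by simp
  next
    fix p q
    assume pq: "p \<in> {..<W} \<times> Va" "q \<in> {..<W} \<times> Va"
    then have mem: "fst p < W" "fst q < W" "snd p \<in> Va" "snd q \<in> Va"
      by auto
    show "win m (fst p) (snd p) \<le> win m (fst q) (snd q) \<longleftrightarrow>
        win h (fst p) (snd p) \<le> win h (fst q) (snd q)"
      by (rule *(1)[OF mem])
    show "win m (fst q) (snd q) - win m (fst p) (snd p) \<le> win h (fst q) (snd q) - win h (fst p) (snd p)"
      if "win m (fst p) (snd p) \<le> win m (fst q) (snd q)"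
      by (rule gap[OF mem that])
  qed
  then show ?thesis
    by fastforce
qed

section \<open>The pasted strategy and its plays\<close>

definition full :: "'v valuation list \<Rightarrow> 'v valuation \<Rightarrow> 'v valuation" where
  "full h e x = (if x \<in> EV then e x else \<tau> h e x)"

lemma hist_full:
  assumes "hist h" "e \<in> EV \<rightarrow>\<^sub>E UNIV"
  shows "hist (h @ [full h e])"
proof -
  have \<tau>: "\<tau> h e \<in> (V - EV) \<rightarrow>\<^sub>E UNIV"
    using strat hist_lists[OF assms(1)] assms(2) unfolding is_strategy_def by blast
  have "restrict (full h e) EV = e"
    using assms(2) by (auto simp: full_def fun_eq_iff PiE_def extensional_def)
  moreover have "restrict (full h e) (V - EV) = \<tau> h e"
    using \<tau> by (auto simp: full_def fun_eq_iff PiE_def extensional_def restrict_def)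
  moreover have "full h e \<in> V \<rightarrow>\<^sub>E UNIV"
    using \<tau> EV_sub by (auto simp: full_def PiE_def extensional_def)
  ultimately show ?thesis
    using assms(1) by (simp add: hist_snoc)
qed

definition jump :: "'v valuation list \<Rightarrow> 'v valuation list" where
  "jump h = (SOME m. m \<in> M \<and> dominates m h)"

lemma jump: "hist h \<Longrightarrow> jump h \<in> M \<and> dominates (jump h) h"
  unfolding jump_def by (rule someI_ex) (rule M(3))

definition relabel :: "(int \<Rightarrow> int) \<Rightarrow> 'v valuation list \<Rightarrow> int \<Rightarrow> int" where
  "relabel F h = (SOME G. strict_mono G \<and> (\<forall>a<W. \<forall>x\<in>Va. G (win (jump h) a x) = F (win h a x)))"

lemma relabel:
  assumes "hist h" "strict_mono F"
  shows "strict_mono (relabel F h) \<and> (\<forall>a<W. \<forall>x\<in>Va. relabel F h (win (jump h) a x) = F (win h a x))"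
  unfolding relabel_def
  using someI_ex[OF dominates_relabel[OF assms(2) conjunct2[OF jump[OF assms(1)]]]] .

text \<open>
  The memory of the new strategy: a history of the old one, and a strictly monotone map that
  turns the values of the look-ahead variables there into those of the actual play.
\<close>

fun update :: "'v valuation list \<times> (int \<Rightarrow> int) \<Rightarrow> 'v valuation \<Rightarrow> 'v valuation list \<times> (int \<Rightarrow> int)" where
  "update (m, F) e = (jump (m @ [full m e]), relabel F (m @ [full m e]))"

text \<open>A strategy sees only the history, so the memory is recomputed from the moves of the
  environment. It starts at \<open>jump []\<close>, because the remembered history must always lie
  in \<open>M\<close>.\<close>

definition memory :: "'v valuation list \<Rightarrow> 'v valuation list \<times> (int \<Rightarrow> int)" where
  "memory es = foldl update (jump [], relabel id []) es"

text \<open>The variables of the environment are future-blind, so the move of the environment passes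
  through unchanged. Values for the colour variables are produced as well; \<open>pasted\<close>
  hides them.\<close>

definition reply :: "'v valuation list \<times> (int \<Rightarrow> int) \<Rightarrow> 'v valuation \<Rightarrow> 'v valuation" where
  "reply s e x = (if x \<in> Va then snd s (full (fst s) e x) else full (fst s) e x)"

definition pasted :: "'v strategy" where
  "pasted h e = restrict (reply (memory (map (\<lambda>v. restrict v EV) h)) e) (V - {xc, yc} - EV)"

lemma is_strategy_pasted: "is_strategy EV (V - {xc, yc}) pasted"
  by (simp add: is_strategy_def pasted_def)

text \<open>\<open>\<sigma>\<close> is the play with the hidden colour values added. A refutation of
  \<open>\<psi>\<close> would make \<open>rk1\<close> drop infinitely often, and a colour block
  makes \<open>rk2\<close> drop in each round, so it cannot visit an element of \<open>M\<close>
  twice.\<close>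

lemma pasted_play:
  assumes cons: "consistent EV (V - {xc, yc}) pasted \<sigma>'"
  obtains \<sigma> where "\<And>i x. x \<in> V - {xc, yc} \<Longrightarrow> \<sigma> i x = \<sigma>' i x"
    and "cltl_sat \<sigma> 0 \<psi>"
    and "\<And>i c. \<exists>j\<ge>i. j \<le> i + card M \<and> (\<sigma> j xc = \<sigma> j yc \<longleftrightarrow> c)"
proof -
  define e where "e i = restrict (\<sigma>' i) EV" for i
  define m where "m i = fst (memory (map e [0..<i]))" for i
  define F where "F i = snd (memory (map e [0..<i]))" for i
  define v where "v i = full (m i) (e i)" for i
  define \<sigma> where "\<sigma> i = reply (memory (map e [0..<i])) (e i)" for i
  have m0: "m 0 = jump []" and F0: "F 0 = relabel id []"
    by (simp_all add: m_def F_def memory_def)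
  have "memory (map e [0..<Suc i]) = update (m i, F i) (e i)" for i
    by (simp add: memory_def m_def F_def)
  then have m_Suc: "m (Suc i) = jump (m i @ [v i])" and F_Suc: "F (Suc i) = relabel (F i) (m i @ [v i])" for i
    by (simp_all add: m_def[of "Suc i"] F_def[of "Suc i"] v_def)
  have e: "e i \<in> EV \<rightarrow>\<^sub>E UNIV" for i
    by (simp add: e_def)
  have inv: "m i \<in> M \<and> strict_mono (F i)" for i
  proof (induction i)
    case 0
    then show ?case
      using jump[OF hist_Nil] relabel[OF hist_Nil, of id] by (simp add: m0 F0 strict_mono_def)
  next
    case (Suc i)
    then have "hist (m i @ [v i])"
      unfolding v_def using hist_full M(2) e by blast
    then show ?case
      using Suc jump relabel unfolding m_Suc F_Suc by blast
  qed
  have hist_m: "hist (m i)" for i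
    using inv M(2) by blast
  have hist_v: "hist (m i @ [v i])" for i
    unfolding v_def using hist_full[OF hist_m e] .
  have dom: "dominates (m (Suc i)) (m i @ [v i])" for i
    unfolding m_Suc using jump[OF hist_v] by blast
  have F_win: "F (Suc i) (win (m (Suc i)) a x) = F i (win (m i @ [v i]) a x)" if "a < W" "x \<in> Va" for i a x
    unfolding m_Suc F_Suc using relabel[OF hist_v, of "F i" i] inv[of i] that by blast
  have \<sigma>_Va: "\<sigma> i x = F i (v i x)" if "x \<in> Va" for i x
    using that by (simp add: \<sigma>_def reply_def F_def v_def m_def)
  have \<sigma>_Vb: "\<sigma> i x = v i x" if "x \<in> Vb" for i x
    using that disjoint by (auto simp: \<sigma>_def reply_def v_def m_def)
  have pad_Suc: "pad W \<sigma> (Suc i + a) = (if Suc a < W then pad W \<sigma> (i + Suc a) else \<sigma> i)"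
    if "a < W" for i a
  proof (cases "Suc a < W")
    case False
    then have "W = Suc a"
      using that by simp
    then show ?thesis
      by (simp add: pad_def)
  qed simp
  have dom0: "dominates (m 0) []"
    unfolding m0 using jump[OF hist_Nil] by blast
  have win_Nil: "win [] a x = 0" if "a < W" for a x
    using that by (simp add: win_def)
  have pad0: "pad W \<sigma> a x = 0" if "a < W" for a x
    using that by (simp add: pad_def)
  \<comment> \<open>Invariant: the values actually played are the images under \<open>F i\<close> of
    those in the remembered window. A jump preserves it by the choice of
    \<open>relabel\<close>.\<close>
  have real_Va: "pad W \<sigma> (i + a) x = F i (win (m i) a x)" if "a < W" "x \<in> Va" for i a x
    using that(1)
  proof (induction i arbitrary: a)
    case 0
    then show ?case
      using relabel[OF hist_Nil, of id] that(2) by (simp add: m0 F0 pad0 win_Nil strict_mono_def)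
  next
    case (Suc i)
    show ?case
      unfolding pad_Suc[OF Suc.prems] F_win[OF Suc.prems that(2)] win_snoc[OF Suc.prems]
      using Suc.IH[of "Suc a"] \<sigma>_Va[OF that(2)] by simp
  qed
  \<comment> \<open>After a jump the remembered future-blind values may differ from those played;
    only their order at each position survives.\<close>
  have real_Vb: "pad W \<sigma> (i + a) x \<le> pad W \<sigma> (i + a) y \<longleftrightarrow> win (m i) a x \<le> win (m i) a y"
    if "a < W" "x \<in> Vb" "y \<in> Vb" for i a x y
    using that(1)
  proof (induction i arbitrary: a)
    case 0
    then show ?case
      using dom0 that(2,3) by (simp add: pad0 win_Nil dominates_def)
  next
    case (Suc i)
    have "win (m (Suc i)) a x \<le> win (m (Suc i)) a y \<longleftrightarrow>
        win (m i @ [v i]) a x \<le> win (m i @ [v i]) a y"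
      using dom[of i] Suc.prems that(2,3) by (simp add: dominates_def)
    then show ?case
      unfolding pad_Suc[OF Suc.prems] win_snoc[OF Suc.prems]
      using Suc.IH[of "Suc a"] \<sigma>_Vb[OF that(2)] \<sigma>_Vb[OF that(3)] by simp
  qed
  have constr: "constr_sat (pad W \<sigma>) i c \<longleftrightarrow> constr_sat (win (m i)) 0 c" if "Constr c \<in> cl" for i c
  proof (rule constr_sat_window)
    show "Constr c \<in> sub \<psi>"
      using that by (simp add: Constr_in_cl)
  next
    fix r a b x y
    assume "a < W" "b < W" "x \<in> Va" "y \<in> Va"
    then show "rel_sat r (pad W \<sigma> (i + a) x) (pad W \<sigma> (i + b) y) \<longleftrightarrow>
        rel_sat r (win (m i) a x) (win (m i) b y)"
      using inv[of i] by (cases r) (simp_all add: real_Va strict_mono_less strict_mono_eq)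
  next
    fix r x y
    assume "x \<in> Vb" "y \<in> Vb"
    then show "rel_sat r (pad W \<sigma> i x) (pad W \<sigma> i y) \<longleftrightarrow> rel_sat r (win (m i) 0 x) (win (m i) 0 y)"
      using real_Vb[OF W_pos, of x y i] real_Vb[OF W_pos, of y x i] by (cases r) auto
  qed
  have sat: "cltl_sat \<sigma> 0 \<psi>"
  proof (rule ccontr)
    assume "\<not> cltl_sat \<sigma> 0 \<psi>"
    then have not_\<Psi>: "\<not> cltl_sat (pad W \<sigma>) 0 \<Psi>"
      unfolding \<Psi>_def cltl_sat_pad .
    define A where "A i = {\<chi>\<in>cl. cltl_sat (pad W \<sigma>) i \<chi>}" for i
    define P where "P = rec_nat cl (\<lambda>i. next_pending cl (A i))"
    have P_Suc: "P (Suc i) = next_pending cl (A i) (P i)" for i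
      by (simp add: P_def)
    have P_cl: "P i \<subseteq> cl" for i
    proof (induction i)
      case 0
      then show ?case
        by (simp add: P_def)
    next
      case (Suc i)
      then show ?case
        by (auto simp: P_Suc next_pending_def remaining_def)
    qed
    have "tableau cl (constr_sat (win (m i)) 0) (A i) (A (Suc i))" for i
      using tableau_of_truth[OF cl_def[symmetric], of "pad W \<sigma>" i]
        tableau_cong[of "constr_sat (pad W \<sigma>) i" "constr_sat (win (m i)) 0", OF constr]
      unfolding A_def by simp
    then have step: "tstep (m i, A i, P i) (m i @ [v i], A (Suc i), P (Suc i))" for i
      using hist_v by (simp add: tstep_def P_Suc)
    \<comment> \<open>The jump keeps \<open>A\<close> and \<open>P\<close> and replaces only the
      history. Domination applies because both sets lie within \<open>cl\<close>.\<close>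
    have dec: "rk1 (m (Suc i), A (Suc i), P (Suc i)) \<le> rk1 (m i @ [v i], A (Suc i), P (Suc i))" for i
      using dom[of i] P_cl[of "Suc i"] unfolding dominates_def A_def by auto
    have le: "rk1 (m (Suc i), A (Suc i), P (Suc i)) \<le> rk1 (m i, A i, P i)" for i
      using dec[of i] rk1_step[OF step[of i]] by simp
    \<comment> \<open>The play starts at \<open>jump []\<close> instead of \<open>[]\<close>; its
      rank is no larger, so membership in \<open>F1\<close> carries over.\<close>
    have "rk1 (m 0, A 0, P 0) \<le> rk1 ([], A 0, P 0)"
      using dom0 P_cl[of 0] unfolding dominates_def A_def by auto
    then have F0: "(m 0, A 0, P 0) \<in> F1"
      by (rule F1_down[rotated]) (rule F1_init, use not_\<Psi> in \<open>simp add: A_def\<close>)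
    have F: "(m i, A i, P i) \<in> F1" for i
    proof (induction i)
      case (Suc i)
      then show ?case
        using F1_down le by blast
    qed (rule F0)
    \<comment> \<open>Truth sets are fair, so resets recur, and at each of them \<open>rk1\<close>
      drops strictly.\<close>
    have "\<exists>j\<ge>i. remaining (A j) (P j) = {}" for i
    proof (rule fair_pending[of P cl A, OF P_Suc _ P_cl finite_cl])
      show "\<exists>j\<ge>i. fulfilled (A j) \<chi>" if "\<chi> \<in> cl" for \<chi> i
        unfolding A_def by (rule fulfilled_of_truth[OF cl_def[symmetric] that])
    qed
    moreover have "rk1 (m (Suc j), A (Suc j), P (Suc j)) < rk1 (m j, A j, P j)"
      if "remaining (A j) (P j) = {}" for j
      using dec[of j] rk1_bad[of "(m j, A j, P j)" "(m j @ [v j], A (Suc j), P (Suc j))"] step[of j] F[of j] that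
      by (simp add: tbad_def)
    ultimately have "\<exists>j\<ge>i. rk1 (m (Suc j), A (Suc j), P (Suc j)) < rk1 (m j, A j, P j)" for i
      by blast
    then show False
      using no_infinite_rank_descent[of "\<lambda>i. rk1 (m i, A i, P i)"] le by blast
  qed
  have bound: "\<exists>j\<ge>i. j \<le> i + card M \<and> (\<sigma> j xc = \<sigma> j yc \<longleftrightarrow> c)" for i c
  proof (rule ccontr)
    assume none: "\<not> ?thesis"
    have less: "rk2 (m (Suc j), \<not> c) < rk2 (m j, \<not> c)" if "i \<le> j" "j \<le> i + card M" for j
    proof -
      have "(\<sigma> j xc = \<sigma> j yc) = (\<not> c)"
        using none that by blast
      \<comment> \<open>Both colour variables pass through the same injective map
        \<open>F j\<close>, so the remembered history shows the colour of the pasted play.\<close>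
      then have "(v j xc = v j yc) = (\<not> c)"
        using inv[of j] by (simp add: \<sigma>_Va xc yc strict_mono_eq)
      then have "cstep (m j, \<not> c) (m j @ [v j], \<not> c)"
        unfolding cstep_def using hist_m hist_v by simp
      then have "rk2 (m j @ [v j], \<not> c) < rk2 (m j, \<not> c)"
        by (rule rk2_step)
      moreover have "rk2 (m (Suc j), \<not> c) \<le> rk2 (m j @ [v j], \<not> c)"
        using dom[of j] by (simp add: dominates_def)
      ultimately show ?thesis
        by simp
    qed
    have decr: "rk2 (m (i + (l + Suc k)), \<not> c) < rk2 (m (i + l), \<not> c)" if "l + k \<le> card M" for l k
      using that
    proof (induction k)
      case 0
      then show ?case
        using less[of "i + l"] by simp
    next
      case (Suc k)
      then have "rk2 (m (i + (l + Suc k)), \<not> c) < rk2 (m (i + l), \<not> c)"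
        by simp
      moreover have "rk2 (m (Suc (i + (l + Suc k))), \<not> c) < rk2 (m (i + (l + Suc k)), \<not> c)"
        using Suc.prems by (intro less) simp_all
      ultimately show ?case
        by simp
    qed
    \<comment> \<open>Strict descent makes \<open>card M + 1\<close> consecutive remembered
      histories distinct, although all of them lie in \<open>M\<close>.\<close>
    have "inj_on (\<lambda>l. m (i + l)) {..card M}"
    proof (rule linorder_inj_onI')
      fix l l'
      assume "l' \<in> {..card M}" "l < l'"
      then obtain k where k: "l' = l + Suc k" "l + k \<le> card M"
        by (auto dest: less_imp_Suc_add)
      then show "m (i + l) \<noteq> m (i + l')"
        using decr[OF k(2)] by auto
    qed
    then have "card {..card M} \<le> card M"
      by (rule card_inj_on_le) (use inv M(1) in auto)
    then show False
      by simp
  qed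
  have "\<sigma> i x = \<sigma>' i x" if "x \<in> V - {xc, yc}" for i x
  proof (cases "x \<in> EV")
    case True
    then have "x \<in> Vb"
      using EV_sub by blast
    then show ?thesis
      using True by (simp add: \<sigma>_Vb v_def full_def e_def)
  next
    case False
    have "restrict (\<sigma>' i) (V - {xc, yc} - EV) = restrict (\<sigma> i) (V - {xc, yc} - EV)"
      using cons unfolding consistent_def pasted_def \<sigma>_def e_def by (simp add: comp_def)
    then show ?thesis
      using that False by (metis DiffI restrict_apply')
  qed
  then show ?thesis
    using that sat bound by blast
qed

end

text \<open>Both transition systems receive their ranks here. Each colour recurs within
  \<open>card M\<close> rounds, and two stretches give the prompt bound
  \<open>2 * card M\<close>.\<close>

lemma (in winning_strategy) system_wins_prompt_of_relativize:
  assumes \<psi>: "\<psi> = relativize (colour xc yc) \<phi>"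
    and over: "prompt_over (Va - {xc, yc}) Vb \<phi>" and pos: "prompt_positive \<phi>"
  shows "system_wins_prompt EV (V - {xc, yc}) \<phi>"
proof -
  obtain rk1 F1 where rk1: "\<And>s s'. tstep s s' \<Longrightarrow> rk1 s' \<le> (rk1 s :: ('v valuation list \<times> 'v cltl set \<times> 'v cltl set) rank)"
      "\<And>s s'. tbad s s' \<Longrightarrow> s \<in> F1 \<Longrightarrow> rk1 s' < rk1 s"
      "\<And>s s'. s \<in> F1 \<Longrightarrow> rk1 s' \<le> rk1 s \<Longrightarrow> s' \<in> F1"
      "\<And>s. s \<notin> F1 \<Longrightarrow> \<exists>f. f 0 = s \<and> (\<forall>i::nat. tstep (f i) (f (Suc i))) \<and>
           (\<forall>i. \<exists>j\<ge>i. tbad (f j) (f (Suc j)))"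
  proof (rule rank_exists[of tbad tstep])
    show "tstep u v" if "tbad u v" for u v
      using that by (simp add: tbad_def case_prod_beta)
  qed (rule that)
  \<comment> \<open>With every step bad, a state outside \<open>F2\<close> would start an infinite
    one-colour run, so \<open>F2\<close> contains all states.\<close>
  obtain rk2 F2 where rk2:
      "\<And>s s'. cstep s s' \<Longrightarrow> s \<in> F2 \<Longrightarrow> rk2 s' < (rk2 s :: ('v valuation list \<times> bool) rank)"
      "\<And>s. s \<notin> F2 \<Longrightarrow> \<exists>f. f 0 = s \<and> (\<forall>i::nat. cstep (f i) (f (Suc i))) \<and>
           (\<forall>i. \<exists>j\<ge>i. cstep (f j) (f (Suc j)))"
    by (rule rank_exists[of cstep cstep]) auto
  interpret ranked_strategy Va Vb EV xc yc \<tau> \<psi> W rk1 F1 rk2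
  proof
    fix A P
    assume "\<Psi> \<notin> A"
    then show "([], A, P) \<in> F1"
      using no_fair_refuting_run rk1(4)[of "([], A, P)"] by blast
  next
    fix t t'
    assume "cstep t t'"
    moreover have "t \<in> F2"
      using no_monochromatic_run rk2(2)[of t] by blast
    ultimately show "rk2 t' < rk2 t"
      by (rule rk2(1))
  qed (fact rk1)+
  have "prompt_sat \<sigma>' 0 (2 * card M) \<phi>" if cons: "consistent EV (V - {xc, yc}) pasted \<sigma>'" for \<sigma>'
  proof -
    obtain \<sigma> where agree: "\<And>i x. x \<in> V - {xc, yc} \<Longrightarrow> \<sigma> i x = \<sigma>' i x"
      and sat: "cltl_sat \<sigma> 0 \<psi>"
      and bound: "\<And>i c. \<exists>j\<ge>i. j \<le> i + card M \<and> (\<sigma> j xc = \<sigma> j yc \<longleftrightarrow> c)"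
      using pasted_play[OF cons] by blast
    have "prompt_sat \<sigma> 0 (2 * card M) \<phi>"
      using relativize_imp_prompt[of "card M" \<sigma> xc yc True \<phi> 0, OF bound pos] sat \<psi> by simp
    moreover have "prompt_sat \<sigma> 0 (2 * card M) \<phi> \<longleftrightarrow> prompt_sat \<sigma>' 0 (2 * card M) \<phi>"
    proof (rule prompt_sat_cong[OF over])
      fix i x
      assume "x \<in> Va - {xc, yc} \<union> Vb"
      then have "x \<in> V - {xc, yc}"
        using xc yc disjoint by blast
      then show "\<sigma> i x = \<sigma>' i x"
        by (rule agree)
    qed
    ultimately show ?thesis
      by simp
  qed
  then show ?thesis
    unfolding system_wins_prompt_def using is_strategy_pasted by blast
qed

section \<open>Assembling the equivalence\<close>

lemma constr_over_relativize:
  assumes "prompt_over Va Vb \<phi>" "xc \<in> Va" "yc \<in> Va" "Constr c \<in> sub (relativize (colour xc yc) \<phi>)"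
  shows "constr_over Va Vb c"
  using assms by (induction \<phi>) (auto simp: Conj_def Imp_def colour_def)

lemma prompt_over_mono: "prompt_over Va Vb \<phi> \<Longrightarrow> Va \<subseteq> Va' \<Longrightarrow> prompt_over Va' Vb \<phi>"
proof (induction \<phi>)
  case (PConstr c)
  then show ?case
    by (cases c) auto
qed auto

theorem theorem22:
  fixes Va Vb EV :: "'v set" and xc yc :: 'v and \<phi> :: "'v prompt_cltl"
  assumes "finite Va" and "finite Vb" and "Va \<inter> Vb = {}"
    and "EV \<subseteq> Vb"
    and "prompt_over Va Vb \<phi>" and "prompt_positive \<phi>"
    and "xc \<notin> Va \<union> Vb" and "yc \<notin> Va \<union> Vb" and "xc \<noteq> yc"
  shows "system_wins_prompt EV (Va \<union> Vb) \<phi> \<longleftrightarrow>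
         system_wins_cltl EV (Va \<union> Vb \<union> {xc, yc}) (colour_cltl xc yc \<phi>)"
proof
  assume "system_wins_prompt EV (Va \<union> Vb) \<phi>"
  then show "system_wins_cltl EV (Va \<union> Vb \<union> {xc, yc}) (colour_cltl xc yc \<phi>)"
    using assms by (intro system_wins_prompt_imp_cltl[where Va = Va and Vb = Vb]) auto
next
  assume "system_wins_cltl EV (Va \<union> Vb \<union> {xc, yc}) (colour_cltl xc yc \<phi>)"
  \<comment> \<open>The colour variables join the look-ahead variables of the coloured game.\<close>
  moreover define Va' where "Va' = Va \<union> {xc, yc}"
  moreover have "Va \<union> Vb \<union> {xc, yc} = Va' \<union> Vb"
    by (auto simp: Va'_def)
  ultimately obtain \<tau> where \<tau>: "is_strategy EV (Va' \<union> Vb) \<tau>"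
      "\<And>\<sigma>. consistent EV (Va' \<union> Vb) \<tau> \<sigma> \<Longrightarrow> cltl_sat \<sigma> 0 (colour_cltl xc yc \<phi>)"
    unfolding system_wins_cltl_def by auto
  define \<psi> where "\<psi> = relativize (colour xc yc) \<phi>"
  have "inj_on Constr {c. Constr c \<in> sub \<psi>}"
    by (simp add: inj_on_def)
  then have "finite {c. Constr c \<in> sub \<psi>}"
    by (rule inj_on_finite[of _ _ "sub \<psi>"]) (auto simp: finite_sub)
  then have "finite (width ` {c. Constr c \<in> sub \<psi>})"
    by simp
  then obtain B where B: "\<And>n. n \<in> width ` {c. Constr c \<in> sub \<psi>} \<Longrightarrow> n < B"
    using finite_nat_set_iff_bounded[of "width ` {c. Constr c \<in> sub \<psi>}"] by blast
  have over': "prompt_over Va' Vb \<phi>"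
    using prompt_over_mono[OF assms(5)] unfolding Va'_def by blast
  \<comment> \<open>All widths are below \<open>B\<close>; taking \<open>Suc B\<close> makes the
    window visibly nonempty.\<close>
  interpret winning_strategy Va' Vb EV xc yc \<tau> \<psi> "Suc B"
  proof
    fix \<sigma> i b
    assume cons: "consistent EV (Va' \<union> Vb) \<tau> \<sigma>"
    show "cltl_sat \<sigma> 0 \<psi>"
      using \<tau>(2)[OF cons] unfolding cltl_sat_colour_cltl \<psi>_def by blast
    show "\<exists>j\<ge>i. (\<sigma> j xc = \<sigma> j yc) = b"
      using \<tau>(2)[OF cons] unfolding cltl_sat_colour_cltl by (cases b) simp_all
  next
    fix c
    assume c: "Constr c \<in> sub \<psi>"
    have "constr_over Va' Vb c"
      using constr_over_relativize[OF over' _ _ c[unfolded \<psi>_def]] by (simp add: Va'_def)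
    moreover have "width c < B"
      using B[of "width c"] c by blast
    ultimately show "constr_over Va' Vb c \<and> width c \<le> Suc B"
      by simp
  qed (use assms \<tau>(1) in \<open>auto simp: Va'_def\<close>)
  have "Va' - {xc, yc} = Va" "Va' \<union> Vb - {xc, yc} = Va \<union> Vb"
    using assms by (auto simp: Va'_def)
  then show "system_wins_prompt EV (Va \<union> Vb) \<phi>"
    using system_wins_prompt_of_relativize[OF \<psi>_def] assms by simp
qed

end
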